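(* Suppose $H$ is a finitely generated stable codimension-$1$ subgroup of a finitely generated group $G$. Then the corresponding CAT(0) cube complex is finite dimensional.
   Context: Stability. Let $X$ be a geodesic metric space and $f\colon \mathbb{R}_{\ge 1}\times\mathbb{R}_{\ge 0}\to\mathbb{R}_{\ge 0}$. A quasigeodesic $\gamma$ in $X$ is $f$-stable if every $(K,\epsilon)$-quasigeodesic with endpoints on $\gamma$ is contained in the $f(K,\epsilon)$-neighborhood of $\gamma$. If $H\le G$ are finitely generated groups (viewed via Cayley graphs with respect to finite generating sets), $H$ is a stable subgroup of $G$ if the inclusion $H\to G$ is a quasi-isometric embedding and there is a single $f$ such that the image of every geodesic of $H$ is an $f$-stable quasigeodesic in $G$. Codimension-1 subgroups and Sageev's cube complex. A subgroup $H\le G$ is codimension-$1$ if there is a subset $A\subseteq G$ with $HA=A$ such that $H\backslash A$ and $H\backslash (G\setminus A)$ are both infinite and $H\backslash (A\,\triangle\, Ag)$ is finite for every $g\in G$ (equivalently, the quotient by $H$ of a Cayley graph of $G$ for a finite generating set has more than one end). Given such $A$, let $\Sigma=\{gA : g\in G\}\cup\{G\setminus gA : g\in G\}$. The corresponding CAT(0) cube complex is defined as follows. Its vertices are the subsets $V\subseteq\Sigma$ such that (a) for each $B\in\Sigma$ exactly one of $B$, $G\setminus B$ belongs to $V$; (b) if $B\in V$, $C\in\Sigma$ and $B\subseteq C$, then $C\in V$; (c) for some (equivalently every) $g\in G$, the symmetric difference of $V$ and $V_g=\{B\in\Sigma : g\in B\}$ is finite. Two vertices $V,V'$ are joined by an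 edge when they differ by replacing exactly one $B$ with $G\setminus B$. An $n$-cube is attached for every subgraph isomorphic to the $1$-skeleton of an $n$-cube, for all $n\ge 2$. *)

theory Defs
  imports "HOL-Analysis.Analysis" "HOL-Algebra.Algebra"
begin

section \<open>Quasigeodesics and stability in a metric space\<close>

text \<open>A metric space is given by its set of points \<open>M\<close> and its distance function \<open>d\<close>.\<close>

definition qi_embedding ::
  "real \<Rightarrow> real \<Rightarrow> 'x set \<Rightarrow> ('x \<Rightarrow> 'x \<Rightarrow> real) \<Rightarrow> 'y set \<Rightarrow> ('y \<Rightarrow> 'y \<Rightarrow> real) \<Rightarrow> ('x \<Rightarrow> 'y) \<Rightarrow> bool"
  where "qi_embedding K \<epsilon> M d N d' f \<longleftrightarrow>
    1 \<le> K \<and> 0 \<le> \<epsilon> \<and> f ` M \<subseteq> N \<and>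
    (\<forall>x\<in>M. \<forall>y\<in>M. d x y / K - \<epsilon> \<le> d' (f x) (f y) \<and> d' (f x) (f y) \<le> K * d x y + \<epsilon>)"

text \<open>Domains are arbitrary nonempty closed intervals, bounded or not, so that rays and lines
  are included.  Quasigeodesics need not be continuous.\<close>

definition closed_interval :: "real set \<Rightarrow> bool"
  where "closed_interval I \<longleftrightarrow> is_interval I \<and> closed I \<and> I \<noteq> {}"

definition quasigeodesic ::
  "real \<Rightarrow> real \<Rightarrow> 'x set \<Rightarrow> ('x \<Rightarrow> 'x \<Rightarrow> real) \<Rightarrow> real set \<Rightarrow> (real \<Rightarrow> 'x) \<Rightarrow> bool"
  where "quasigeodesic K \<epsilon> M d I \<gamma> \<longleftrightarrow> closed_interval I \<and> qi_embedding K \<epsilon> I dist M d \<gamma>"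

definition geodesic :: "'x set \<Rightarrow> ('x \<Rightarrow> 'x \<Rightarrow> real) \<Rightarrow> real set \<Rightarrow> (real \<Rightarrow> 'x) \<Rightarrow> bool"
  where "geodesic M d I \<gamma> \<longleftrightarrow>
    closed_interval I \<and> \<gamma> ` I \<subseteq> M \<and> (\<forall>s\<in>I. \<forall>t\<in>I. d (\<gamma> s) (\<gamma> t) = \<bar>s - t\<bar>)"

definition stable_quasigeodesic ::
  "(real \<Rightarrow> real \<Rightarrow> real) \<Rightarrow> 'x set \<Rightarrow> ('x \<Rightarrow> 'x \<Rightarrow> real) \<Rightarrow> real set \<Rightarrow> (real \<Rightarrow> 'x) \<Rightarrow> bool"
  where "stable_quasigeodesic f M d I \<gamma> \<longleftrightarrow>
    (\<exists>K \<epsilon>. quasigeodesic K \<epsilon> M d I \<gamma>) \<and>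
    (\<forall>K\<ge>1. \<forall>\<epsilon>\<ge>0. \<forall>a b \<eta>.
       a \<le> b \<and> quasigeodesic K \<epsilon> M d {a..b} \<eta> \<and> \<eta> a \<in> \<gamma> ` I \<and> \<eta> b \<in> \<gamma> ` I \<longrightarrow>
       (\<forall>t\<in>{a..b}. \<exists>s\<in>I. d (\<eta> t) (\<gamma> s) \<le> f K \<epsilon>))"


section \<open>Cayley graphs as geodesic metric spaces\<close>

definition finite_generating_set :: "('a, 'b) monoid_scheme \<Rightarrow> 'a set \<Rightarrow> bool"
  where "finite_generating_set G S \<longleftrightarrow> finite S \<and> S \<subseteq> carrier G \<and> generate G S = carrier G"

definition finitely_generated :: "('a, 'b) monoid_scheme \<Rightarrow> bool"
  where "finitely_generated G \<longleftrightarrow> (\<exists>S. finite_generating_set G S)"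

definition word_length :: "('a, 'b) monoid_scheme \<Rightarrow> 'a set \<Rightarrow> 'a \<Rightarrow> nat"
  where "word_length G S g = (LEAST n. \<exists>ws. length ws = n \<and>
    set ws \<subseteq> S \<union> (\<lambda>s. inv\<^bsub>G\<^esub> s) ` S \<and> foldr (mult G) ws \<one>\<^bsub>G\<^esub> = g)"

definition word_dist :: "('a, 'b) monoid_scheme \<Rightarrow> 'a set \<Rightarrow> 'a \<Rightarrow> 'a \<Rightarrow> real"
  where "word_dist G S g h = real (word_length G S (inv\<^bsub>G\<^esub> g \<otimes>\<^bsub>G\<^esub> h))"

text \<open>The Cayley graph is taken to be a simple graph, an edge being the set of its two endpoints;
  loops and multiple edges would not affect distances between vertices.\<close>

definition cayley_simplices :: "('a, 'b) monoid_scheme \<Rightarrow> 'a set \<Rightarrow> 'a set set"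
  where "cayley_simplices G S = {{g} | g. g \<in> carrier G} \<union>
    {{g, g \<otimes>\<^bsub>G\<^esub> s} | g s. g \<in> carrier G \<and> s \<in> S \<and> g \<otimes>\<^bsub>G\<^esub> s \<noteq> g}"

text \<open>Points of the geometric realization are given by their barycentric coordinates: a point on
  the edge with endpoints \<open>x\<close>, \<open>y\<close> is a function \<open>p\<close> with \<open>p x + p y = 1\<close>, its distance to
  \<open>x\<close> along the edge being \<open>1 - p x\<close>.\<close>

definition cayley_graph :: "('a, 'b) monoid_scheme \<Rightarrow> 'a set \<Rightarrow> ('a \<Rightarrow> real) set"
  where "cayley_graph G S = {p. \<exists>e\<in>cayley_simplices G S.
    (\<forall>x. 0 \<le> p x) \<and> (\<forall>x. x \<notin> e \<longrightarrow> p x = 0) \<and> sum p e = 1}"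

abbreviation vertex :: "'a \<Rightarrow> 'a \<Rightarrow> real"
  where "vertex g \<equiv> indicator {g}"

text \<open>The path metric with edges of length \<open>1\<close>.  For points of a common edge the sum is the
  \<open>\<ell>\<^sup>1\<close>-distance of the coordinates, which is twice their distance along the edge.  Otherwise
  a path has to leave the edge of \<open>p\<close> through an endpoint \<open>x\<close> and enter the edge of \<open>q\<close> through
  an endpoint \<open>y\<close>.\<close>

definition cayley_dist :: "('a, 'b) monoid_scheme \<Rightarrow> 'a set \<Rightarrow> ('a \<Rightarrow> real) \<Rightarrow> ('a \<Rightarrow> real) \<Rightarrow> real"
  where "cayley_dist G S p q =
    (if \<exists>e\<in>cayley_simplices G S. \<forall>x. x \<notin> e \<longrightarrow> p x = 0 \<and> q x = 0
     then (\<Sum>x | p x \<noteq> 0 \<or> q x \<noteq> 0. \<bar>p x - q x\<bar>) / 2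
     else Min {(1 - p x) + word_dist G S x y + (1 - q y) | x y. p x \<noteq> 0 \<and> q y \<noteq> 0})"


section \<open>Stable subgroups\<close>

text \<open>The inclusion of \<open>H\<close> into \<open>G\<close> is a map between the vertex sets of the Cayley graphs, and
  \<open>\<iota>\<close> is an extension of it to the edges.  Such a quasi-isometric embedding \<open>\<iota>\<close> exists iff the
  inclusion of vertices is a quasi-isometric embedding for the word metrics, and any two choices
  are at bounded distance.  Stability does not depend on the choice of \<open>S\<close>, \<open>T\<close>, \<open>\<iota>\<close>.\<close>

definition stable_subgroup :: "('a, 'b) monoid_scheme \<Rightarrow> 'a set \<Rightarrow> bool"
  where "stable_subgroup G H \<longleftrightarrow> subgroup H G \<and>
    (\<exists>S T \<iota>. finite_generating_set G S \<and> finite_generating_set (G\<lparr>carrier := H\<rparr>) T \<and>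
      (\<forall>h\<in>H. \<iota> (vertex h) = vertex h) \<and>
      (\<exists>K \<epsilon>. qi_embedding K \<epsilon>
         (cayley_graph (G\<lparr>carrier := H\<rparr>) T) (cayley_dist (G\<lparr>carrier := H\<rparr>) T)
         (cayley_graph G S) (cayley_dist G S) \<iota>) \<and>
      (\<exists>f. (\<forall>K\<ge>1. \<forall>\<epsilon>\<ge>0. 0 \<le> f K \<epsilon>) \<and>
        (\<forall>I \<gamma>. geodesic (cayley_graph (G\<lparr>carrier := H\<rparr>) T) (cayley_dist (G\<lparr>carrier := H\<rparr>) T) I \<gamma> \<longrightarrow>
           stable_quasigeodesic f (cayley_graph G S) (cayley_dist G S) I (\<iota> \<circ> \<gamma>))))"


section \<open>Codimension-1 subgroups\<close>

text \<open>The quotient of a left \<open>H\<close>-invariant set \<open>B\<close> by \<open>H\<close> is the set of right cosets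
  \<open>Hx\<close> with \<open>x \<in> B\<close>.\<close>

definition left_quotient :: "('a, 'b) monoid_scheme \<Rightarrow> 'a set \<Rightarrow> 'a set \<Rightarrow> 'a set set"
  where "left_quotient G H B = (\<lambda>x. H #>\<^bsub>G\<^esub> x) ` B"

definition codimension_one_witness :: "('a, 'b) monoid_scheme \<Rightarrow> 'a set \<Rightarrow> 'a set \<Rightarrow> bool"
  where "codimension_one_witness G H A \<longleftrightarrow>
    A \<subseteq> carrier G \<and> H <#>\<^bsub>G\<^esub> A = A \<and>
    infinite (left_quotient G H A) \<and> infinite (left_quotient G H (carrier G - A)) \<and>
    (\<forall>g\<in>carrier G. finite (left_quotient G H (sym_diff A (A #>\<^bsub>G\<^esub> g))))"

definition codimension_one_subgroup :: "('a, 'b) monoid_scheme \<Rightarrow> 'a set \<Rightarrow> bool"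
  where "codimension_one_subgroup G H \<longleftrightarrow> subgroup H G \<and> (\<exists>A. codimension_one_witness G H A)"


section \<open>Sageev's cube complex\<close>

definition halfspaces :: "('a, 'b) monoid_scheme \<Rightarrow> 'a set \<Rightarrow> 'a set set"
  where "halfspaces G A =
    {g <#\<^bsub>G\<^esub> A | g. g \<in> carrier G} \<union> {carrier G - (g <#\<^bsub>G\<^esub> A) | g. g \<in> carrier G}"

definition sageev_vertices :: "('a, 'b) monoid_scheme \<Rightarrow> 'a set \<Rightarrow> 'a set set set"
  where "sageev_vertices G A = {V. V \<subseteq> halfspaces G A \<and>
    (\<forall>B\<in>halfspaces G A. (B \<in> V) \<noteq> (carrier G - B \<in> V)) \<and>
    (\<forall>B\<in>V. \<forall>C\<in>halfspaces G A. B \<subseteq> C \<longrightarrow> C \<in> V) \<and>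
    (\<exists>g\<in>carrier G. finite (sym_diff V {B \<in> halfspaces G A. g \<in> B}))}"

definition sageev_edges :: "('a, 'b) monoid_scheme \<Rightarrow> 'a set \<Rightarrow> 'a set set set set"
  where "sageev_edges G A = {{V, V'} | V V'. V \<in> sageev_vertices G A \<and> V' \<in> sageev_vertices G A \<and>
    (\<exists>B\<in>V. V' = insert (carrier G - B) (V - {B}))}"

text \<open>The vertices of the standard \<open>n\<close>-cube are the subsets of \<open>{..<n}\<close>, its edges join subsets
  that differ in one element.  A cube of the complex is identified with its \<open>1\<close>-skeleton, a
  not necessarily induced subgraph \<open>(W, F)\<close>; the cubes of dimension \<open>0\<close> and \<open>1\<close> are the vertices
  and edges.\<close>

definition sageev_cubes ::
  "('a, 'b) monoid_scheme \<Rightarrow> 'a set \<Rightarrow> nat \<Rightarrow> ('a set set set \<times> 'a set set set set) set"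
  where "sageev_cubes G A n = {(W, F). W \<subseteq> sageev_vertices G A \<and> F \<subseteq> sageev_edges G A \<and>
    (\<exists>\<phi>. bij_betw \<phi> (Pow {..<n}) W \<and>
         F = {{\<phi> J, \<phi> (insert i J)} | i J. J \<subseteq> {..<n} \<and> i < n \<and> i \<notin> J})}"

definition sageev_complex_finite_dimensional :: "('a, 'b) monoid_scheme \<Rightarrow> 'a set \<Rightarrow> bool"
  where "sageev_complex_finite_dimensional G A \<longleftrightarrow>
    (\<exists>N. \<forall>n. sageev_cubes G A n \<noteq> {} \<longrightarrow> n \<le> N)"

end

theory Submission
  imports Defs
begin

text \<open>
  The coboundary of \<open>A\<close> is finite modulo \<open>H\<close>, and \<open>H\<close> is finitely generated, so if two translates
  \<open>gA\<close> and \<open>xA\<close> cross, then the cosets \<open>gH\<close> and \<open>xH\<close> are within a distance that does not depend on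
  \<open>g\<close> and \<open>x\<close> (\<open>crossing_cosets_close\<close>).  An \<open>n\<close>-cube of Sageev's complex gives \<open>n\<close> pairwise crossing
  halfspaces, namely those that are flipped along the edges at one vertex of the cube
  (\<open>cube_crossing_halfspaces\<close>).  Different hyperplanes belong to different cosets, because
  \<open>HA = A\<close>.  So the dimension is bounded by the number of cosets of \<open>H\<close> that can be pairwise close,
  and it remains to show that this number is finite (\<open>bounded_packing\<close>).

  Let \<open>H\<close> be one of these cosets.  Everything about the others is derived from one construction
  (\<open>quasigeodesic_seq_to_closest\<close>): a path that follows a quasigeodesic up to the point closest to
  \<open>z\<close> and then goes straight to \<open>z\<close> is a quasigeodesic.  If its ends are near a coset of \<open>H\<close>, then
  by stability it stays near that coset.  This yields that triangles in \<open>H\<close> are thin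
  (\<open>thin_triangles\<close>), that the part of \<open>H\<close> near another coset, its trace, is quasiconvex
  (\<open>traces_quasiconvex\<close>), and that the traces of two cosets that are close to each other and to \<open>H\<close>
  intersect (\<open>close_to_two_cosets\<close>).  In a tree, pairwise intersecting subtrees have a common point,
  and thinness carries the proof of this over to traces: all cosets in question pass within a uniform
  distance of one point of \<open>H\<close> (\<open>traces_helly\<close>).  Balls in a finitely generated group are finite and
  cosets are disjoint, which bounds the number of cosets.

  The definition of stability speaks about geodesics and quasigeodesics in the geometric
  realization of Cayley graphs, whereas the argument takes place at vertices.  The translation fills
  in geodesic sequences of vertices to geodesics (\<open>polygonal_path_geodesic\<close>) and reads sequences of
  vertices as discontinuous quasigeodesics (\<open>step_path_quasigeodesic\<close>).
\<close>

section \<open>The word metric\<close>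

abbreviation nat_dist :: "nat \<Rightarrow> nat \<Rightarrow> real" where "nat_dist i j \<equiv> \<bar>real i - real j\<bar>"

locale word_metric = group G for G (structure) +
  fixes S
  assumes generators: "finite_generating_set G S"
begin

abbreviation letters where "letters \<equiv> S \<union> (\<lambda>s. inv s) ` S"

abbreviation word_value where "word_value ws \<equiv> foldr (mult G) ws \<one>"

abbreviation d where "d \<equiv> word_dist G S"

lemma letters_closed: "letters \<subseteq> carrier G"
  using generators by (auto simp: finite_generating_set_def)

lemma letter_closed: "s \<in> letters \<Longrightarrow> s \<in> carrier G"
  using letters_closed by blast

lemma word_value_closed: "set ws \<subseteq> letters \<Longrightarrow> word_value ws \<in> carrier G"
proof (induction ws)
  case (Cons a ws)
  then show ?case using letter_closed[of a] by simp
qed simp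

lemma word_value_append:
  "set us \<subseteq> letters \<Longrightarrow> set vs \<subseteq> letters \<Longrightarrow> word_value (us @ vs) = word_value us \<otimes> word_value vs"
proof (induction us)
  case Nil
  then show ?case using word_value_closed by simp
next
  case (Cons a us)
  then have "a \<in> carrier G" "word_value us \<in> carrier G" "word_value vs \<in> carrier G"
    using word_value_closed[of us] word_value_closed[of vs] letter_closed[of a] by simp_all
  then show ?case using Cons by (simp add: m_assoc)
qed

lemma word_exists:
  assumes "g \<in> carrier G"
  shows "\<exists>ws. set ws \<subseteq> letters \<and> word_value ws = g"
proof -
  have "g \<in> generate G S" using assms generators by (simp add: finite_generating_set_def)
  then show ?thesis
  proof induction
    case one
    show ?case by (rule exI[of _ "[]"]) simp
  next
    case (incl h)
    then show ?case using letter_closed[of h] by (intro exI[of _ "[h]"]) simp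
  next
    case (inv h)
    then have "inv h \<in> letters" by blast
    then show ?case using letter_closed[of "inv h"] by (intro exI[of _ "[inv h]"]) simp
  next
    case (eng h1 h2)
    then obtain us vs where "set us \<subseteq> letters" "word_value us = h1"
        "set vs \<subseteq> letters" "word_value vs = h2" by blast
    then show ?case using word_value_append[of us vs] by (intro exI[of _ "us @ vs"]) simp
  qed
qed

lemma shortest_word:
  assumes "g \<in> carrier G"
  shows "\<exists>ws. length ws = word_length G S g \<and> set ws \<subseteq> letters \<and> word_value ws = g"
proof -
  have "\<exists>n ws. length ws = n \<and> set ws \<subseteq> letters \<and> word_value ws = g"
    using word_exists[OF assms] by blast
  from LeastI_ex[OF this] show ?thesis unfolding word_length_def .
qed

lemma word_length_le: "set ws \<subseteq> letters \<Longrightarrow> word_length G S (word_value ws) \<le> length ws"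
  unfolding word_length_def by (rule Least_le) blast

lemma word_length_one: "word_length G S \<one> = 0"
  using word_length_le[of "[]"] by simp

lemma word_length_eq_0: "g \<in> carrier G \<Longrightarrow> word_length G S g = 0 \<Longrightarrow> g = \<one>"
  using shortest_word[of g] by auto

lemma word_length_mult:
  assumes "g \<in> carrier G" "h \<in> carrier G"
  shows "word_length G S (g \<otimes> h) \<le> word_length G S g + word_length G S h"
proof -
  obtain us vs where "length us = word_length G S g" "set us \<subseteq> letters" "word_value us = g"
      "length vs = word_length G S h" "set vs \<subseteq> letters" "word_value vs = h"
    using shortest_word assms by meson
  then show ?thesis using word_length_le[of "us @ vs"] word_value_append[of us vs] by simp
qed

lemma word_value_inverse:
  "set ws \<subseteq> letters \<Longrightarrow> word_value (rev (map (\<lambda>s. inv s) ws)) = inv (word_value ws)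
     \<and> set (map (\<lambda>s. inv s) ws) \<subseteq> letters"
proof (induction ws)
  case (Cons a ws)
  have a: "a \<in> letters" "a \<in> carrier G" using Cons.prems letters_closed by auto
  have S: "S \<subseteq> carrier G" using letters_closed by blast
  have ia: "inv a \<in> letters" using a(1) S by auto
  have ws: "set ws \<subseteq> letters" using Cons.prems by simp
  note IH = Cons.IH[OF ws]
  have 1: "set (rev (map (\<lambda>s. inv s) ws)) \<subseteq> letters" "set [inv a] \<subseteq> letters" using IH ia by simp_all
  have "word_value (rev (map (\<lambda>s. inv s) (a # ws))) = inv (word_value ws) \<otimes> (inv a \<otimes> \<one>)"
    using word_value_append[OF 1] IH by simp
  also have "\<dots> = inv (a \<otimes> word_value ws)"
    using a(2) word_value_closed[OF ws] by (simp add: inv_mult_group)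
  finally show ?case using IH ia by simp
qed simp

lemma word_length_inv_le:
  assumes "g \<in> carrier G" shows "word_length G S (inv g) \<le> word_length G S g"
proof -
  obtain ws where ws: "length ws = word_length G S g" "set ws \<subseteq> letters" "word_value ws = g"
    using shortest_word assms by meson
  have "set (rev (map (\<lambda>s. inv s) ws)) \<subseteq> letters" using word_value_inverse[OF ws(2)] by simp
  from word_length_le[OF this] show ?thesis using word_value_inverse[OF ws(2)] ws by simp
qed

lemma word_dist_nonneg: "0 \<le> d x y" by (simp add: word_dist_def)

lemma word_dist_self: "x \<in> carrier G \<Longrightarrow> d x x = 0"
  by (simp add: word_dist_def word_length_one)

lemma word_dist_eq_0: "x \<in> carrier G \<Longrightarrow> y \<in> carrier G \<Longrightarrow> d x y = 0 \<Longrightarrow> x = y"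
  using word_length_eq_0[of "inv x \<otimes> y"] inv_equality inv_inv
  by (metis inv_closed m_closed of_nat_eq_0_iff word_dist_def)

lemma word_dist_sym:
  assumes "x \<in> carrier G" "y \<in> carrier G" shows "d x y = d y x"
proof -
  have "inv (inv x \<otimes> y) = inv y \<otimes> x" "inv (inv y \<otimes> x) = inv x \<otimes> y"
    using assms by (simp_all add: inv_mult_group)
  then show ?thesis
    using word_length_inv_le[of "inv x \<otimes> y"] word_length_inv_le[of "inv y \<otimes> x"] assms
    by (simp add: word_dist_def)
qed

lemma word_dist_triangle:
  assumes "x \<in> carrier G" "y \<in> carrier G" "z \<in> carrier G" shows "d x z \<le> d x y + d y z"
proof -
  have "(inv x \<otimes> y) \<otimes> (inv y \<otimes> z) = inv x \<otimes> z"
    using assms by (metis inv_closed inv_solve_left m_assoc m_closed)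
  then show ?thesis using word_length_mult[of "inv x \<otimes> y" "inv y \<otimes> z"] assms
    by (simp add: word_dist_def flip: of_nat_add)
qed

lemma word_dist_left_mult:
  assumes "g \<in> carrier G" "x \<in> carrier G" "y \<in> carrier G" shows "d (g \<otimes> x) (g \<otimes> y) = d x y"
proof -
  have "inv (g \<otimes> x) \<otimes> (g \<otimes> y) = inv x \<otimes> y"
    using assms by (simp add: inv_mult_group m_assoc inv_solve_left')
  then show ?thesis by (simp add: word_dist_def)
qed

lemma finite_ball: "finite {g \<in> carrier G. d \<one> g \<le> r}"
proof -
  have fin: "finite letters" using generators by (auto simp: finite_generating_set_def)
  have "{g \<in> carrier G. d \<one> g \<le> r}
      \<subseteq> word_value ` {ws. set ws \<subseteq> letters \<and> length ws \<le> nat \<lfloor>r\<rfloor>}"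
  proof
    fix g assume "g \<in> {g \<in> carrier G. d \<one> g \<le> r}"
    then have g: "g \<in> carrier G" "real (word_length G S g) \<le> r" by (auto simp: word_dist_def)
    then obtain ws where "length ws = word_length G S g" "set ws \<subseteq> letters" "word_value ws = g"
      using shortest_word by meson
    moreover have "word_length G S g \<le> nat \<lfloor>r\<rfloor>" using g(2) by linarith
    ultimately show "g \<in> word_value ` {ws. set ws \<subseteq> letters \<and> length ws \<le> nat \<lfloor>r\<rfloor>}" by force
  qed
  then show ?thesis using finite_lists_length_le[OF fin] finite_surj by blast
qed

definition geodesic_seq :: "nat \<Rightarrow> (nat \<Rightarrow> 'a) \<Rightarrow> bool" where
  "geodesic_seq n \<sigma> \<longleftrightarrow> \<sigma> ` {..n} \<subseteq> carrier G \<and> (\<forall>i\<le>n. \<forall>j\<le>n. d (\<sigma> i) (\<sigma> j) = nat_dist i j)"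

lemma geodesic_seq_exists:
  assumes x: "x \<in> carrier G" and y: "y \<in> carrier G"
  shows "\<exists>n \<sigma>. real n = d x y \<and> geodesic_seq n \<sigma> \<and> \<sigma> 0 = x \<and> \<sigma> n = y"
proof -
  define n where "n = word_length G S (inv x \<otimes> y)"
  obtain ws where ws: "length ws = n" "set ws \<subseteq> letters" "word_value ws = inv x \<otimes> y"
    using shortest_word[of "inv x \<otimes> y"] x y unfolding n_def by auto
  define \<sigma> where "\<sigma> i = x \<otimes> word_value (take i ws)" for i
  have pre: "set (take i ws) \<subseteq> letters" for i using ws(2) set_take_subset by fastforce
  have suf: "set (drop i ws) \<subseteq> letters" for i using ws(2) set_drop_subset by fastforce
  have cl: "\<sigma> i \<in> carrier G" for i unfolding \<sigma>_def using x word_value_closed[OF pre] by simp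
  have up: "d (\<sigma> i) (\<sigma> j) \<le> real j - real i" if "i \<le> j" for i j
  proof -
    define u where "u = take (j - i) (drop i ws)"
    have u: "set u \<subseteq> letters" unfolding u_def using suf[of i] set_take_subset by fastforce
    have "take j ws = take i ws @ u" unfolding u_def
      using that by (metis le_add_diff_inverse take_add)
    then have "\<sigma> j = \<sigma> i \<otimes> word_value u" unfolding \<sigma>_def
      using word_value_append[OF pre u] word_value_closed[OF pre] word_value_closed[OF u] x
      by (simp add: m_assoc)
    then have "inv (\<sigma> i) \<otimes> \<sigma> j = word_value u"
      using cl[of i] word_value_closed[OF u] by (metis inv_solve_left cl)
    then have "d (\<sigma> i) (\<sigma> j) \<le> length u" using word_length_le[OF u] by (simp add: word_dist_def)
    also have "length u \<le> j - i" unfolding u_def by simp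
    finally show ?thesis using that by (simp add: of_nat_diff)
  qed
  have s0: "\<sigma> 0 = x" unfolding \<sigma>_def using x by simp
  have sn: "\<sigma> n = y" unfolding \<sigma>_def using ws x y by (simp add: m_assoc[symmetric])
  have tot: "d (\<sigma> 0) (\<sigma> n) = n" unfolding s0 sn by (simp add: word_dist_def n_def)
  have eq: "d (\<sigma> i) (\<sigma> j) = real j - real i" if "i \<le> j" "j \<le> n" for i j
  proof -
    have "real n \<le> d (\<sigma> 0) (\<sigma> i) + d (\<sigma> i) (\<sigma> j) + d (\<sigma> j) (\<sigma> n)"
      using tot word_dist_triangle[of "\<sigma> 0" "\<sigma> i" "\<sigma> n"] word_dist_triangle[of "\<sigma> i" "\<sigma> j" "\<sigma> n"] cl by auto
    then show ?thesis using up[of 0 i] up[of i j] up[of j n] that by simp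
  qed
  have "d (\<sigma> i) (\<sigma> j) = nat_dist i j" if "i \<le> n" "j \<le> n" for i j
    using eq[of i j] eq[of j i] word_dist_sym[OF cl[of i] cl[of j]] that
    by (cases "i \<le> j") auto
  then have "geodesic_seq n \<sigma>" unfolding geodesic_seq_def using cl by auto
  then show ?thesis using s0 sn n_def by (auto simp: word_dist_def intro!: exI[of _ n] exI[of _ \<sigma>])
qed

definition between :: "'a \<Rightarrow> 'a \<Rightarrow> 'a \<Rightarrow> bool" where
  "between a v b \<longleftrightarrow> a \<in> carrier G \<and> v \<in> carrier G \<and> b \<in> carrier G \<and> d a v + d v b = d a b"

lemma between_sym: "between a v b \<longleftrightarrow> between b v a"
  unfolding between_def using word_dist_sym by (metis add.commute)

lemma geodesic_seq_between:
  assumes "geodesic_seq n \<sigma>" "i \<le> n" shows "between (\<sigma> 0) (\<sigma> i) (\<sigma> n)"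
  using assms unfolding geodesic_seq_def between_def by auto

lemma geodesic_seq_rev:
  assumes "geodesic_seq n \<sigma>" shows "geodesic_seq n (\<lambda>i. \<sigma> (n - i))"
  using assms unfolding geodesic_seq_def by auto

text \<open>Two geodesic sequences that meet in a point between their outer ends concatenate to one: a
  shortcut between them would shorten the distance of the outer ends.\<close>

lemma geodesic_seq_through:
  assumes "between a v b"
  shows "\<exists>n \<sigma> k. geodesic_seq n \<sigma> \<and> \<sigma> 0 = a \<and> \<sigma> n = b \<and> k \<le> n \<and> \<sigma> k = v"
proof -
  have c: "a \<in> carrier G" "v \<in> carrier G" "b \<in> carrier G" and s: "d a v + d v b = d a b"
    using assms unfolding between_def by auto
  obtain k \<sigma> where k: "real k = d a v" "geodesic_seq k \<sigma>" "\<sigma> 0 = a" "\<sigma> k = v"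
    using geodesic_seq_exists c by meson
  obtain m \<tau> where m: "real m = d v b" "geodesic_seq m \<tau>" "\<tau> 0 = v" "\<tau> m = b"
    using geodesic_seq_exists c by meson
  define \<rho> where "\<rho> i = (if i \<le> k then \<sigma> i else \<tau> (i - k))" for i
  have r2: "\<rho> i = \<tau> (i - k)" if "k \<le> i" for i using that k m by (auto simp: \<rho>_def)
  have sc: "\<sigma> i \<in> carrier G" if "i \<le> k" for i using k(2) that unfolding geodesic_seq_def by auto
  have tc: "\<tau> i \<in> carrier G" if "i \<le> m" for i using m(2) that unfolding geodesic_seq_def by auto
  have cl: "\<rho> i \<in> carrier G" if "i \<le> k + m" for i using that sc tc by (auto simp: \<rho>_def)
  have mixed: "d (\<sigma> i) (\<tau> j) = real (k - i) + j" if "i \<le> k" "j \<le> m" for i j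
  proof -
    have e: "d a (\<sigma> i) = i" "d (\<sigma> i) v = real (k - i)" "d v (\<tau> j) = j" "d (\<tau> j) b = real (m - j)"
      using k(2-4) m(2-4) that unfolding geodesic_seq_def by auto
    have "d a b \<le> d a (\<sigma> i) + d (\<sigma> i) (\<tau> j) + d (\<tau> j) b"
      using word_dist_triangle[of a "\<sigma> i" b] word_dist_triangle[of "\<sigma> i" "\<tau> j" b] c sc tc that by auto
    moreover have "d (\<sigma> i) (\<tau> j) \<le> d (\<sigma> i) v + d v (\<tau> j)"
      using word_dist_triangle[of "\<sigma> i" v "\<tau> j"] c sc tc that by auto
    ultimately show ?thesis using e s k(1) m(1) that by (simp add: of_nat_diff)
  qed
  have "d (\<rho> i) (\<rho> j) = nat_dist i j" if ij: "i \<le> k + m" "j \<le> k + m" for i j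
  proof -
    consider "i \<le> k" "j \<le> k" | "k \<le> i" "k \<le> j" | "i \<le> k" "k \<le> j" | "k \<le> i" "j \<le> k" by linarith
    then show ?thesis
    proof cases
      case 1 then show ?thesis using k(2) unfolding geodesic_seq_def \<rho>_def by auto
    next
      case 2
      then have "d (\<rho> i) (\<rho> j) = nat_dist (i - k) (j - k)"
        using m(2) ij unfolding geodesic_seq_def by (auto simp: r2)
      then show ?thesis using 2 by auto
    next
      case 3
      then have "d (\<rho> i) (\<rho> j) = real (k - i) + real (j - k)"
        using mixed[of i "j - k"] ij r2 by (auto simp: \<rho>_def)
      then show ?thesis using 3 by (auto simp: of_nat_diff)
    next
      case 4
      then have "d (\<rho> j) (\<rho> i) = real (k - j) + real (i - k)"
        using mixed[of j "i - k"] ij r2 by (auto simp: \<rho>_def)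
      then show ?thesis using 4 word_dist_sym[OF cl cl] ij by (auto simp: of_nat_diff)
    qed
  qed
  then have "geodesic_seq (k + m) \<rho>" unfolding geodesic_seq_def using cl by auto
  moreover have "\<rho> 0 = a" "\<rho> (k + m) = b" "\<rho> k = v" using k m r2[of "k + m"] by (auto simp: \<rho>_def)
  ultimately show ?thesis by (metis le_add1)
qed

end

section \<open>Distances in the Cayley graph\<close>

context word_metric begin

abbreviation graph where "graph \<equiv> cayley_graph G S"
abbreviation graph_dist where "graph_dist \<equiv> cayley_dist G S"

text \<open>A step by the inverse of a generator is an edge as well, read from its other end, so that edges
  can be recognized by the word metric alone.\<close>

lemma simplex_iff:
  "e \<in> cayley_simplices G S \<longleftrightarrow> (\<exists>x\<in>carrier G. \<exists>y\<in>carrier G. e = {x, y} \<and> d x y \<le> 1)"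
proof
  assume "e \<in> cayley_simplices G S"
  then consider g where "g \<in> carrier G" "e = {g}"
    | g s where "g \<in> carrier G" "s \<in> S" "e = {g, g \<otimes> s}"
    unfolding cayley_simplices_def by blast
  then show "\<exists>x\<in>carrier G. \<exists>y\<in>carrier G. e = {x, y} \<and> d x y \<le> 1"
  proof cases
    case 1
    then show ?thesis using word_dist_self by (intro bexI[of _ g]) auto
  next
    case 2
    have s: "s \<in> carrier G" using 2 letter_closed[of s] by blast
    have "word_length G S s \<le> 1" using word_length_le[of "[s]"] 2 s by simp
    moreover have "inv g \<otimes> (g \<otimes> s) = s" using 2 s by (simp add: m_assoc[symmetric])
    ultimately have "d g (g \<otimes> s) \<le> 1" by (simp add: word_dist_def)
    then show ?thesis using 2 s by blast
  qed
next
  assume "\<exists>x\<in>carrier G. \<exists>y\<in>carrier G. e = {x, y} \<and> d x y \<le> 1"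
  then obtain x y where xy: "x \<in> carrier G" "y \<in> carrier G" "e = {x, y}" "d x y \<le> 1" by blast
  show "e \<in> cayley_simplices G S"
  proof (cases "x = y")
    case True
    then show ?thesis using xy unfolding cayley_simplices_def by auto
  next
    case False
    obtain ws where ws: "length ws = word_length G S (inv x \<otimes> y)" "set ws \<subseteq> letters"
        "word_value ws = inv x \<otimes> y"
      using shortest_word[of "inv x \<otimes> y"] xy by auto
    have "length ws \<le> 1" using xy(4) ws(1) by (simp add: word_dist_def)
    then consider "ws = []" | s where "ws = [s]" by (cases ws) auto
    then show ?thesis
    proof cases
      case 1
      then have "inv x \<otimes> y = \<one>" using ws by simp
      then show ?thesis using False xy by (metis inv_solve_left r_one one_closed)
    next
      case 2
      have s: "s \<in> letters" "s \<in> carrier G" using ws 2 letter_closed[of s] by auto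
      have y: "y = x \<otimes> s" using ws(3) 2 s xy by (simp add: inv_solve_left)
      show ?thesis
      proof (cases "s \<in> S")
        case True
        then show ?thesis using xy False y unfolding cayley_simplices_def by blast
      next
        case F: False
        then obtain t where t: "t \<in> S" "s = inv t" using s by blast
        then have "t \<in> carrier G" using letter_closed[of t] by blast
        then have "x = y \<otimes> t" using y t xy by (simp add: m_assoc)
        then have "e = {y, y \<otimes> t}" "y \<otimes> t \<noteq> y" using xy False by auto
        then show ?thesis using xy(2) t(1) unfolding cayley_simplices_def by blast
      qed
    qed
  qed
qed

lemma cayley_graphD:
  assumes "p \<in> graph"
  obtains e where "e \<in> cayley_simplices G S" "{x. p x \<noteq> 0} \<subseteq> e" "finite {x. p x \<noteq> 0}"
    "{x. p x \<noteq> 0} \<subseteq> carrier G" "sum p {x. p x \<noteq> 0} = 1" "\<And>x. 0 \<le> p x" "{x. p x \<noteq> 0} \<noteq> {}"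
proof -
  obtain e where e: "e \<in> cayley_simplices G S" "\<forall>x. 0 \<le> p x" "\<forall>x. x \<notin> e \<longrightarrow> p x = 0" "sum p e = 1"
    using assms unfolding cayley_graph_def by auto
  have fe: "finite e" "e \<subseteq> carrier G" using e(1) unfolding simplex_iff by auto
  have sub: "{x. p x \<noteq> 0} \<subseteq> e" using e(3) by auto
  have "sum p {x. p x \<noteq> 0} = sum p e" by (rule sum.mono_neutral_left) (use fe sub in auto)
  then have s: "sum p {x. p x \<noteq> 0} = 1" using e(4) by simp
  then have "{x. p x \<noteq> 0} \<noteq> {}" by (metis sum.empty zero_neq_one)
  then show thesis using that[of e] e(1,2) fe sub finite_subset[OF sub fe(1)] s by auto
qed

lemma vertex_in_graph: "g \<in> carrier G \<Longrightarrow> vertex g \<in> graph"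
  unfolding cayley_graph_def cayley_simplices_def by (auto intro!: exI[of _ "{g}"] simp: indicator_def)

lemma graph_dist_sym:
  assumes "p \<in> graph" "q \<in> graph" shows "graph_dist p q = graph_dist q p"
proof -
  have "{(1 - p x) + d x y + (1 - q y) | x y. p x \<noteq> 0 \<and> q y \<noteq> 0}
      = {(1 - q x) + d x y + (1 - p y) | x y. q x \<noteq> 0 \<and> p y \<noteq> 0}"
  proof -
    have "{x. p x \<noteq> 0} \<subseteq> carrier G" using cayley_graphD[OF assms(1)] by metis
    moreover have "{x. q x \<noteq> 0} \<subseteq> carrier G" using cayley_graphD[OF assms(2)] by metis
    ultimately have c: "x \<in> carrier G" if "p x \<noteq> 0 \<or> q x \<noteq> 0" for x using that by blast
    show ?thesis (is "?A = ?B")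
    proof (intro equalityI subsetI)
      fix r assume "r \<in> ?A"
      then obtain x y where xy: "r = (1 - p x) + d x y + (1 - q y)" "p x \<noteq> 0" "q y \<noteq> 0" by blast
      then have "r = (1 - q y) + d y x + (1 - p x)" using word_dist_sym[of x y] c by auto
      then show "r \<in> ?B" using xy(2,3) by (intro CollectI exI[of _ y] exI[of _ x]) blast
    next
      fix r assume "r \<in> ?B"
      then obtain x y where xy: "r = (1 - q x) + d x y + (1 - p y)" "q x \<noteq> 0" "p y \<noteq> 0" by blast
      then have "r = (1 - p y) + d y x + (1 - q x)" using word_dist_sym[of x y] c by auto
      then show "r \<in> ?A" using xy(2,3) by (intro CollectI exI[of _ y] exI[of _ x]) blast
    qed
  qed
  then show ?thesis unfolding cayley_dist_def
    by (simp only: abs_minus_commute[of "p _" "q _"] conj_commute[of "p _ = 0" "q _ = 0"]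
        disj_commute[of "p _ \<noteq> 0" "q _ \<noteq> 0"])
qed

lemma graph_dist_vertex_support:
  assumes p: "p \<in> graph" and x: "p x \<noteq> 0" shows "graph_dist (vertex x) p = 1 - p x"
proof -
  obtain e where e: "e \<in> cayley_simplices G S" "{x. p x \<noteq> 0} \<subseteq> e" "finite {x. p x \<noteq> 0}"
    "{x. p x \<noteq> 0} \<subseteq> carrier G" "sum p {x. p x \<noteq> 0} = 1" "\<And>x. 0 \<le> p x"
    using cayley_graphD[OF p] by metis
  let ?A = "{x. p x \<noteq> 0}"
  have A: "{z. (vertex x z :: real) \<noteq> 0 \<or> p z \<noteq> 0} = ?A" using x by (auto simp: indicator_def)
  have c: "\<exists>e\<in>cayley_simplices G S. \<forall>z. z \<notin> e \<longrightarrow> (vertex x z :: real) = 0 \<and> p z = 0"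
    using e(1,2) x by (intro bexI[of _ e]) (auto simp: indicator_def)
  have split: "sum p ?A = p x + sum p (?A - {x})" using x e(3) by (simp add: sum.remove)
  then have px: "p x \<le> 1" using e(5,6) by (smt (verit) sum_nonneg)
  have "(\<Sum>z\<in>?A. \<bar>vertex x z - p z\<bar>) = \<bar>vertex x x - p x\<bar> + (\<Sum>z\<in>?A - {x}. \<bar>vertex x z - p z\<bar>)"
    using x e(3) by (simp add: sum.remove)
  also have "(\<Sum>z\<in>?A - {x}. \<bar>vertex x z - p z\<bar>) = sum p (?A - {x})"
    using e(6) by (intro sum.cong) (auto simp: indicator_def)
  also have "\<bar>vertex x x - p x\<bar> = 1 - p x" using px by simp
  finally have "(\<Sum>z\<in>?A. \<bar>vertex x z - p z\<bar>) = 2 * (1 - p x)" using split e(5) by simp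
  then show ?thesis unfolding cayley_dist_def if_P[OF c] A by simp
qed

text \<open>A shortest path from a vertex to \<open>p\<close> enters the edge of \<open>p\<close> through an endpoint \<open>x\<close>.  If the vertex
  lies on that edge, then \<open>x\<close> is the vertex itself, unless \<open>p\<close> is the opposite endpoint.\<close>

lemma graph_dist_vertex_point:
  assumes g: "g \<in> carrier G" and p: "p \<in> graph"
  shows "\<exists>x\<in>carrier G. p x \<noteq> 0 \<and> graph_dist (vertex g) p = d g x + (1 - p x)"
proof -
  obtain e where e: "e \<in> cayley_simplices G S" "{x. p x \<noteq> 0} \<subseteq> e" "finite {x. p x \<noteq> 0}"
    "{x. p x \<noteq> 0} \<subseteq> carrier G" "sum p {x. p x \<noteq> 0} = 1" "\<And>x. 0 \<le> p x" "{x. p x \<noteq> 0} \<noteq> {}"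
    using cayley_graphD[OF p] by metis
  show ?thesis
  proof (cases "p g \<noteq> 0")
    case True
    then show ?thesis using graph_dist_vertex_support[OF p, of g] g word_dist_self by auto
  next
    case pg: False
    show ?thesis
    proof (cases "\<exists>e\<in>cayley_simplices G S. \<forall>z. z \<notin> e \<longrightarrow> (vertex g z :: real) = 0 \<and> p z = 0")
      case True
      then obtain e' where e': "e' \<in> cayley_simplices G S" "\<forall>z. z \<notin> e' \<longrightarrow> (vertex g z :: real) = 0 \<and> p z = 0"
        by blast
      obtain a b where ab: "a \<in> carrier G" "b \<in> carrier G" "e' = {a, b}" "d a b \<le> 1"
        using e'(1) unfolding simplex_iff by blast
      have "g \<in> e'" using e'(2) by (metis indicator_simps(1) singletonI zero_neq_one)
      then obtain y where y: "e' = {g, y}" "y \<in> carrier G" "d g y \<le> 1"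
        using ab word_dist_sym by (metis doubleton_eq_iff insertE singletonD)
      have sub: "{x. p x \<noteq> 0} \<subseteq> {y}" using e'(2) pg y by auto
      then have A: "{x. p x \<noteq> 0} = {y}" using e(7) by blast
      then have py: "p y = 1" using e(5) by simp
      have gy: "g \<noteq> y" using pg py by auto
      have "word_length G S (inv g \<otimes> y) \<noteq> 0" using gy word_dist_eq_0[of g y] g y by (auto simp: word_dist_def)
      then have "d g y = 1" using y(3) by (simp add: word_dist_def)
      moreover have "graph_dist (vertex g) p = 1"
      proof -
        have "{z. (vertex g z :: real) \<noteq> 0 \<or> p z \<noteq> 0} = {g, y}" using A by (auto simp: indicator_def)
        then show ?thesis unfolding cayley_dist_def if_P[OF True] using gy py pg by (simp add: indicator_def)
      qed
      ultimately have "p y \<noteq> 0 \<and> graph_dist (vertex g) p = d g y + (1 - p y)" using py by simp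
      then show ?thesis using y(2) by blast
    next
      case False
      let ?M = "{(1 - (vertex g x :: real)) + d x y + (1 - p y) | x y. (vertex g x :: real) \<noteq> 0 \<and> p y \<noteq> 0}"
      have M: "?M = (\<lambda>y. d g y + (1 - p y)) ` {y. p y \<noteq> 0}" by (auto simp: indicator_def)
      then have "Min ?M \<in> ?M" using e(3,7) by (intro Min_in) auto
      then obtain y where y: "p y \<noteq> 0" "Min ?M = d g y + (1 - p y)" unfolding M by blast
      have "graph_dist (vertex g) p = Min ?M" unfolding cayley_dist_def if_not_P[OF False] ..
      then show ?thesis using y e(4) by auto
    qed
  qed
qed

lemma graph_dist_vertices:
  assumes "g \<in> carrier G" "h \<in> carrier G" shows "graph_dist (vertex g) (vertex h) = d g h"
  using graph_dist_vertex_point[OF assms(1) vertex_in_graph[OF assms(2)]]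
  by (auto simp: indicator_def split: if_splits)

text \<open>The triangle inequality for two vertices and an arbitrary middle point.  It transfers estimates
  at the image of a point of an edge, which may be any point of the graph, to estimates between
  vertices.\<close>

lemma word_dist_le_via_point:
  assumes g: "g \<in> carrier G" and h: "h \<in> carrier G" and p: "p \<in> graph"
  shows "d g h \<le> graph_dist (vertex g) p + graph_dist p (vertex h)"
proof -
  obtain e where e: "e \<in> cayley_simplices G S" "{x. p x \<noteq> 0} \<subseteq> e" "finite {x. p x \<noteq> 0}"
    "{x. p x \<noteq> 0} \<subseteq> carrier G" "sum p {x. p x \<noteq> 0} = 1" "\<And>x. 0 \<le> p x"
    using cayley_graphD[OF p] by metis
  obtain x where x: "x \<in> carrier G" "p x \<noteq> 0" "graph_dist (vertex g) p = d g x + (1 - p x)"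
    using graph_dist_vertex_point[OF g p] by blast
  obtain y where y: "y \<in> carrier G" "p y \<noteq> 0" "graph_dist (vertex h) p = d h y + (1 - p y)"
    using graph_dist_vertex_point[OF h p] by blast
  have "d x y \<le> (1 - p x) + (1 - p y)"
  proof (cases "x = y")
    case True
    have "p x \<le> 1" using e(5,6) member_le_sum[of x "{x. p x \<noteq> 0}" p] e(3) x(2) by auto
    then show ?thesis using True x word_dist_self by simp
  next
    case False
    have "sum p {x, y} \<le> sum p {x. p x \<noteq> 0}" using x y e(3,6) by (intro sum_mono2) auto
    then have "p x + p y \<le> 1" using False e(5) by simp
    moreover have "d x y \<le> 1"
      using e(1,2) x(2) y(2) False word_dist_sym unfolding simplex_iff
      by (smt (verit, ccfv_threshold) insertE mem_Collect_eq singletonD subset_iff)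
    ultimately show ?thesis by simp
  qed
  moreover have "d g h \<le> d g x + d x y + d y h"
    using word_dist_triangle[of g x h] word_dist_triangle[of x y h] g h x y by auto
  ultimately show ?thesis
    using x(3) y(3) graph_dist_sym[OF p vertex_in_graph[OF h]] word_dist_sym[of h y] h y(1) by simp
qed

text \<open>The piecewise linear path through the vertices \<open>\<sigma> 0, \<dots>, \<sigma> n\<close>: its barycentric coordinate at
  \<open>\<sigma> i\<close> is a tent function of time, centred at \<open>i\<close>.  For injective \<open>\<sigma>\<close> the sum has at most one
  term, and serves to find the index of \<open>z\<close>.\<close>

definition polygonal_path :: "nat \<Rightarrow> (nat \<Rightarrow> 'a) \<Rightarrow> real \<Rightarrow> 'a \<Rightarrow> real" where
  "polygonal_path n \<sigma> s z = (\<Sum>i | i \<le> n \<and> \<sigma> i = z. max 0 (1 - \<bar>s - real i\<bar>))"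

context
  fixes n \<sigma> assumes geo: "geodesic_seq n \<sigma>"
begin

lemma geodesic_seq_inj: "i \<le> n \<Longrightarrow> j \<le> n \<Longrightarrow> \<sigma> i = \<sigma> j \<longleftrightarrow> i = j"
proof -
  assume ij: "i \<le> n" "j \<le> n"
  then have "\<sigma> i \<in> carrier G" "d (\<sigma> i) (\<sigma> j) = nat_dist i j"
    using geo unfolding geodesic_seq_def by auto
  then show ?thesis using word_dist_self[of "\<sigma> i"] by auto
qed

lemma polygonal_path_at: "i \<le> n \<Longrightarrow> polygonal_path n \<sigma> s (\<sigma> i) = max 0 (1 - \<bar>s - real i\<bar>)"
proof -
  assume "i \<le> n"
  then have "{j. j \<le> n \<and> \<sigma> j = \<sigma> i} = {i}" using geodesic_seq_inj by auto
  then show ?thesis unfolding polygonal_path_def by simp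
qed

lemma polygonal_path_support:
  "{z. polygonal_path n \<sigma> s z \<noteq> 0} = \<sigma> ` {i. i \<le> n \<and> \<bar>s - real i\<bar> < 1}"
proof (intro equalityI subsetI)
  fix z assume "z \<in> {z. polygonal_path n \<sigma> s z \<noteq> 0}"
  then have nz: "polygonal_path n \<sigma> s z \<noteq> 0" by simp
  then have "{i. i \<le> n \<and> \<sigma> i = z} \<noteq> {}" unfolding polygonal_path_def by (metis (no_types) sum.empty)
  then obtain i where i: "i \<le> n" "\<sigma> i = z" by blast
  then have "\<bar>s - real i\<bar> < 1" using nz polygonal_path_at[OF i(1), of s] by (auto simp: max_def split: if_splits)
  then show "z \<in> \<sigma> ` {i. i \<le> n \<and> \<bar>s - real i\<bar> < 1}" using i by blast
qed (auto simp: polygonal_path_at)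

lemma polygonal_path_vertex: "k \<le> n \<Longrightarrow> polygonal_path n \<sigma> (real k) = vertex (\<sigma> k)"
proof
  fix z assume k: "k \<le> n"
  have "{i. i \<le> n \<and> \<bar>real k - real i\<bar> < 1} = {k}" using k by auto
  then have "{z. polygonal_path n \<sigma> (real k) z \<noteq> 0} = {\<sigma> k}" using polygonal_path_support by simp
  then show "polygonal_path n \<sigma> (real k) z = vertex (\<sigma> k) z"
    using polygonal_path_at[OF k, of "real k"] by (cases "z = \<sigma> k") (auto simp: indicator_def)
qed

lemma unit_interval_support:
  assumes "0 \<le> s" "s \<le> real n"
  defines "k \<equiv> nat \<lfloor>s\<rfloor>"
  shows "k \<le> n" "real k \<le> s" "s < real k + 1"
    "{i. i \<le> n \<and> \<bar>s - real i\<bar> < 1} = (if real k < s then {k, k + 1} else {k})"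
proof -
  show k: "k \<le> n" "real k \<le> s" "s < real k + 1" using assms by (simp_all, linarith+)
  have 1: "k + 1 \<le> n" if "real k < s" using that assms(2) by linarith
  have 2: "i = k \<or> i = k + 1 \<and> real k < s" if "\<bar>s - real i\<bar> < 1" for i using that k by linarith
  show "{i. i \<le> n \<and> \<bar>s - real i\<bar> < 1} = (if real k < s then {k, k + 1} else {k})"
  proof (cases "real k < s")
    case True
    then show ?thesis using k 1 2 by auto
  next
    case False
    then have "s = real k" using k by simp
    then show ?thesis using k by auto
  qed
qed

lemma polygonal_path_in_graph:
  assumes "0 \<le> s" "s \<le> real n" shows "polygonal_path n \<sigma> s \<in> graph"
proof -
  define k where "k = nat \<lfloor>s\<rfloor>"
  note u = unit_interval_support[OF assms, folded k_def]
  have nn: "0 \<le> polygonal_path n \<sigma> s z" for z unfolding polygonal_path_def by (intro sum_nonneg) auto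
  show ?thesis
  proof (cases "real k < s")
    case True
    then have k1: "k + 1 \<le> n" using assms(2) by linarith
    have c: "\<sigma> k \<in> carrier G" "\<sigma> (k + 1) \<in> carrier G" "d (\<sigma> k) (\<sigma> (k + 1)) \<le> 1"
      using geo u(1) k1 unfolding geodesic_seq_def by auto
    then have e: "{\<sigma> k, \<sigma> (k + 1)} \<in> cayley_simplices G S" unfolding simplex_iff by blast
    have ne: "\<sigma> k \<noteq> \<sigma> (k + 1)" using geodesic_seq_inj u(1) k1 by simp
    have "{z. polygonal_path n \<sigma> s z \<noteq> 0} = {\<sigma> k, \<sigma> (k + 1)}"
      unfolding polygonal_path_support u(4) using True by simp
    moreover have "sum (polygonal_path n \<sigma> s) {\<sigma> k, \<sigma> (k + 1)} = 1"
      using ne polygonal_path_at[OF u(1), of s] polygonal_path_at[OF k1, of s] u True by simp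
    ultimately show ?thesis unfolding cayley_graph_def using nn e by blast
  next
    case False
    then have "s = real k" using u by simp
    then show ?thesis using polygonal_path_vertex[OF u(1)] vertex_in_graph geo u(1)
      unfolding geodesic_seq_def by auto
  qed
qed

text \<open>If both times lie in one unit interval, then both points lie on one edge and the coordinates
  give the distance directly.  Otherwise the points have no edge in common, the candidates for the
  minimum are \<open>\<bar>s - i\<bar> + \<bar>i - j\<bar> + \<bar>j - t\<bar>\<close>, and the least of them is attained by rounding \<open>s\<close> up and
  \<open>t\<close> down.\<close>

lemma polygonal_path_dist:
  assumes st: "0 \<le> s" "s \<le> t" "t \<le> real n"
  shows "graph_dist (polygonal_path n \<sigma> s) (polygonal_path n \<sigma> t) = t - s"
proof -
  let ?p = "polygonal_path n \<sigma> s" and ?q = "polygonal_path n \<sigma> t"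
  let ?I = "{i. i \<le> n \<and> \<bar>s - real i\<bar> < 1}" and ?J = "{i. i \<le> n \<and> \<bar>t - real i\<bar> < 1}"
  define k where "k = nat \<lfloor>s\<rfloor>"
  define l where "l = nat \<lfloor>t\<rfloor>"
  have sn: "s \<le> real n" and t0: "0 \<le> t" using st by auto
  note u = unit_interval_support[OF st(1) sn, folded k_def]
  note v = unit_interval_support[OF t0 st(3), folded l_def]
  have dij: "d (\<sigma> i) (\<sigma> j) = nat_dist i j" if "i \<le> n" "j \<le> n" for i j
    using geo that unfolding geodesic_seq_def by auto
  have kl: "k \<le> l" using u v st by linarith
  have fin: "finite ?I" "finite ?J" by auto
  show ?thesis
  proof (cases "s = t \<or> t \<le> real k + 1")
    case True
    show ?thesis
    proof (cases "s = t")
      case True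
      have p: "?p \<in> graph" by (rule polygonal_path_in_graph) (use st in auto)
      then obtain e where "e \<in> cayley_simplices G S" "{x. ?p x \<noteq> 0} \<subseteq> e" using cayley_graphD by metis
      then have "\<exists>e\<in>cayley_simplices G S. \<forall>x. x \<notin> e \<longrightarrow> ?p x = 0 \<and> ?p x = 0" by blast
      then show ?thesis unfolding cayley_dist_def using True by simp
    next
      case False
      then have tk: "t \<le> real k + 1" "s < t" using True st by auto
      then have k1: "k + 1 \<le> n" using u st(3) by linarith
      have I: "?I \<subseteq> {k, k + 1}" using u(4) by auto
      have J: "?J \<subseteq> {k, k + 1}" using tk u(2) by auto
      let ?e = "{\<sigma> k, \<sigma> (k + 1)}"
      have sub: "{x. ?p x \<noteq> 0 \<or> ?q x \<noteq> 0} \<subseteq> ?e"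
        using polygonal_path_support[of s] polygonal_path_support[of t] I J by auto
      have "\<sigma> k \<in> carrier G" "\<sigma> (k + 1) \<in> carrier G" "d (\<sigma> k) (\<sigma> (k + 1)) \<le> 1"
        using geo u(1) k1 unfolding geodesic_seq_def by auto
      then have "?e \<in> cayley_simplices G S" unfolding simplex_iff by blast
      then have c: "\<exists>e\<in>cayley_simplices G S. \<forall>x. x \<notin> e \<longrightarrow> ?p x = 0 \<and> ?q x = 0" using sub by blast
      have ne: "\<sigma> k \<noteq> \<sigma> (k + 1)" using geodesic_seq_inj u(1) k1 by simp
      have "(\<Sum>x | ?p x \<noteq> 0 \<or> ?q x \<noteq> 0. \<bar>?p x - ?q x\<bar>) = (\<Sum>x\<in>?e. \<bar>?p x - ?q x\<bar>)"
        by (rule sum.mono_neutral_left) (use sub in auto)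
      also have "\<dots> = 2 * (t - s)" using ne u(2,3) tk st
        by (simp add: polygonal_path_at[OF u(1)] polygonal_path_at[OF k1, simplified])
      finally show ?thesis unfolding cayley_dist_def if_P[OF c] by simp
    qed
  next
    case False
    then have tk: "s < t" "real k + 1 < t" using st by auto
    \<comment> \<open>The supports contain vertices \<open>\<sigma> k\<close> and \<open>\<sigma> m\<close> with \<open>m \<ge> k + 2\<close>, too far apart for an edge.\<close>
    have nc: "\<not> (\<exists>e\<in>cayley_simplices G S. \<forall>x. x \<notin> e \<longrightarrow> ?p x = 0 \<and> ?q x = 0)"
    proof
      assume "\<exists>e\<in>cayley_simplices G S. \<forall>x. x \<notin> e \<longrightarrow> ?p x = 0 \<and> ?q x = 0"
      then obtain e where e: "e \<in> cayley_simplices G S" "\<forall>x. x \<notin> e \<longrightarrow> ?p x = 0 \<and> ?q x = 0" by blast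
      define m where "m = (if real l < t then l + 1 else l)"
      have m: "m \<in> ?J" unfolding v(4) m_def by simp
      have mk: "k + 2 \<le> m" using tk v(2,3) unfolding m_def by (cases "real l < t"; simp; linarith)
      have kI: "k \<in> ?I" unfolding u(4) by simp
      have "?p (\<sigma> k) \<noteq> 0" "?q (\<sigma> m) \<noteq> 0"
        using kI m polygonal_path_support[of s] polygonal_path_support[of t] by blast+
      then have "\<sigma> k \<in> e" "\<sigma> m \<in> e" using e(2) by blast+
      moreover have "d (\<sigma> k) (\<sigma> m) > 1" "d (\<sigma> m) (\<sigma> k) > 1" using dij kI m mk by auto
      moreover have "\<sigma> k \<noteq> \<sigma> m" using geodesic_seq_inj kI m mk by auto
      ultimately show False using e(1) unfolding simplex_iff by fastforce
    qed
    let ?M = "{(1 - ?p x) + d x y + (1 - ?q y) | x y. ?p x \<noteq> 0 \<and> ?q y \<noteq> 0}"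
    let ?f = "\<lambda>(i, j). \<bar>s - real i\<bar> + nat_dist i j + \<bar>t - real j\<bar>"
    have f: "(1 - ?p (\<sigma> i)) + d (\<sigma> i) (\<sigma> j) + (1 - ?q (\<sigma> j)) = ?f (i, j)" if "i \<in> ?I" "j \<in> ?J" for i j
      using that dij by (auto simp: polygonal_path_at)
    have M: "?M = ?f ` (?I \<times> ?J)"
    proof (intro equalityI subsetI)
      fix r assume "r \<in> ?M"
      then obtain x y where xy: "r = (1 - ?p x) + d x y + (1 - ?q y)" "?p x \<noteq> 0" "?q y \<noteq> 0" by blast
      then obtain i j where "i \<in> ?I" "x = \<sigma> i" "j \<in> ?J" "y = \<sigma> j"
        using polygonal_path_support[of s] polygonal_path_support[of t] by blast
      then show "r \<in> ?f ` (?I \<times> ?J)" using f xy(1) by (intro image_eqI[of _ _ "(i, j)"]) auto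
    next
      fix r assume "r \<in> ?f ` (?I \<times> ?J)"
      then obtain i j where ij: "i \<in> ?I" "j \<in> ?J" "r = ?f (i, j)" by blast
      then have "?p (\<sigma> i) \<noteq> 0" "?q (\<sigma> j) \<noteq> 0"
        using polygonal_path_support[of s] polygonal_path_support[of t] by blast+
      moreover have "r = (1 - ?p (\<sigma> i)) + d (\<sigma> i) (\<sigma> j) + (1 - ?q (\<sigma> j))"
        using f[OF ij(1,2)] ij(3) by (rule trans[OF _ sym, rotated])
      ultimately show "r \<in> ?M" by (intro CollectI exI[of _ "\<sigma> i"] exI[of _ "\<sigma> j"]) blast
    qed
    define a where "a = (if real k < s then k + 1 else k)"
    have a: "a \<in> ?I" unfolding u(4) a_def by simp
    have l: "l \<in> ?J" unfolding v(4) by simp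
    have al: "s \<le> real a" "a \<le> l" "real l \<le> t"
      using u(2,3) v(2,3) tk unfolding a_def by (cases "real k < s"; simp; linarith)+
    have "Min ?M = t - s" unfolding M
    proof (rule Min_eqI)
      show "finite (?f ` (?I \<times> ?J))" using fin by blast
      show "\<And>y. y \<in> ?f ` (?I \<times> ?J) \<Longrightarrow> t - s \<le> y" by auto
      have "t - s = ?f (a, l)" using al by simp
      then show "t - s \<in> ?f ` (?I \<times> ?J)" using a l by blast
    qed
    then show ?thesis unfolding cayley_dist_def if_not_P[OF nc] .
  qed
qed

lemma polygonal_path_geodesic: "geodesic graph graph_dist {0..real n} (polygonal_path n \<sigma>)"
  unfolding geodesic_def closed_interval_def
proof (intro conjI ballI)
  fix s t assume "s \<in> {0..real n}" "t \<in> {0..real n}"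
  then show "graph_dist (polygonal_path n \<sigma> s) (polygonal_path n \<sigma> t) = \<bar>s - t\<bar>"
    using polygonal_path_dist[of s t] polygonal_path_dist[of t s]
      graph_dist_sym[OF polygonal_path_in_graph[of s] polygonal_path_in_graph[of t]]
    by (cases "s \<le> t") auto
qed (auto simp: polygonal_path_in_graph is_interval_cc)

end

end

section \<open>Discrete quasigeodesics\<close>

context word_metric begin

abbreviation quasigeodesic_seq :: "real \<Rightarrow> real \<Rightarrow> nat \<Rightarrow> (nat \<Rightarrow> 'a) \<Rightarrow> bool" where
  "quasigeodesic_seq K \<epsilon> n w \<equiv> qi_embedding K \<epsilon> {..n} nat_dist (carrier G) d w"

lemma quasigeodesic_seqI:
  assumes "1 \<le> K" "0 \<le> \<epsilon>" and cl: "\<And>i. i \<le> n \<Longrightarrow> w i \<in> carrier G"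
    and lo: "\<And>i j. i \<le> j \<Longrightarrow> j \<le> n \<Longrightarrow> (real j - real i) / K - \<epsilon> \<le> d (w i) (w j)"
    and up: "\<And>i j. i \<le> j \<Longrightarrow> j \<le> n \<Longrightarrow> d (w i) (w j) \<le> K * (real j - real i) + \<epsilon>"
  shows "quasigeodesic_seq K \<epsilon> n w"
proof -
  have "nat_dist i j / K - \<epsilon> \<le> d (w i) (w j) \<and> d (w i) (w j) \<le> K * nat_dist i j + \<epsilon>"
    if "i \<le> n" "j \<le> n" for i j
    using lo[of i j] up[of i j] lo[of j i] up[of j i] word_dist_sym[OF cl cl] that
    by (cases "i \<le> j") auto
  then show ?thesis unfolding qi_embedding_def using assms by auto
qed

lemma quasigeodesic_seqD:
  assumes "quasigeodesic_seq K \<epsilon> n w"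
  shows "1 \<le> K" "0 \<le> \<epsilon>" "i \<le> n \<Longrightarrow> w i \<in> carrier G"
    "i \<le> n \<Longrightarrow> j \<le> n \<Longrightarrow> nat_dist i j / K - \<epsilon> \<le> d (w i) (w j)"
    "i \<le> n \<Longrightarrow> j \<le> n \<Longrightarrow> d (w i) (w j) \<le> K * nat_dist i j + \<epsilon>"
  using assms unfolding qi_embedding_def by auto

text \<open>Quasigeodesics need not be continuous, so a sequence of vertices can be run through as a step
  function.  Rounding the time to an integer adds at most \<open>K\<close> to the additive constant.\<close>

lemma step_path_quasigeodesic:
  assumes w: "quasigeodesic_seq K \<epsilon> n w"
  shows "quasigeodesic K (\<epsilon> + K) graph graph_dist {0..real n} (\<lambda>t. vertex (w (nat \<lfloor>t\<rfloor>)))"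
proof -
  note D = quasigeodesic_seqD[OF w]
  have fl: "nat \<lfloor>t\<rfloor> \<le> n" if "t \<in> {0..real n}" for t using that by (simp, linarith)
  have "\<bar>s - t\<bar> / K - (\<epsilon> + K) \<le> graph_dist (vertex (w (nat \<lfloor>s\<rfloor>))) (vertex (w (nat \<lfloor>t\<rfloor>))) \<and>
      graph_dist (vertex (w (nat \<lfloor>s\<rfloor>))) (vertex (w (nat \<lfloor>t\<rfloor>))) \<le> K * \<bar>s - t\<bar> + (\<epsilon> + K)"
    if st: "s \<in> {0..real n}" "t \<in> {0..real n}" for s t
  proof -
    define i where "i = nat \<lfloor>s\<rfloor>"
    define j where "j = nat \<lfloor>t\<rfloor>"
    have ij: "i \<le> n" "j \<le> n" using fl st unfolding i_def j_def by auto
    have "real i \<le> s" "s < real i + 1" "real j \<le> t" "t < real j + 1"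
      using st unfolding i_def j_def by (auto; linarith)+
    then have e: "\<bar>s - t\<bar> \<le> nat_dist i j + 1" "nat_dist i j \<le> \<bar>s - t\<bar> + 1" by linarith+
    have "\<bar>s - t\<bar> / K \<le> (nat_dist i j + 1) / K" using e D(1) by (intro divide_right_mono) auto
    also have "\<dots> \<le> nat_dist i j / K + K"
    proof -
      have "1 / K \<le> 1" using D(1) by simp
      then have "1 / K \<le> K" using D(1) by linarith
      then show ?thesis by (simp add: add_divide_distrib)
    qed
    finally have 1: "\<bar>s - t\<bar> / K \<le> nat_dist i j / K + K" .
    have 2: "K * nat_dist i j \<le> K * \<bar>s - t\<bar> + K"
      using mult_left_mono[OF e(2), of K] D(1) by (simp add: algebra_simps)
    have "graph_dist (vertex (w i)) (vertex (w j)) = d (w i) (w j)"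
      by (rule graph_dist_vertices) (use ij D(3) in auto)
    then show ?thesis using D(4,5)[OF ij] 1 2 unfolding i_def[symmetric] j_def[symmetric] by linarith
  qed
  then show ?thesis
    unfolding quasigeodesic_def qi_embedding_def closed_interval_def
    using D(1,2) D(3)[OF fl] vertex_in_graph by (auto simp: is_interval_cc dist_real_def)
qed

lemma quasigeodesic_seq_perturb:
  assumes w: "quasigeodesic_seq K \<epsilon> n w" and R: "0 \<le> R"
    and w': "\<And>i. i \<le> n \<Longrightarrow> w' i \<in> carrier G" "\<And>i. i \<le> n \<Longrightarrow> d (w i) (w' i) \<le> R"
  shows "quasigeodesic_seq K (\<epsilon> + 2 * R) n w'"
proof -
  note D = quasigeodesic_seqD[OF w]
  have b: "\<bar>d (w i) (w j) - d (w' i) (w' j)\<bar> \<le> 2 * R" if ij: "i \<le> n" "j \<le> n" for i j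
  proof -
    have c: "w i \<in> carrier G" "w j \<in> carrier G" "w' i \<in> carrier G" "w' j \<in> carrier G"
      using D(3) w' ij by auto
    have "d (w i) (w j) \<le> d (w i) (w' i) + d (w' i) (w' j) + d (w' j) (w j)"
      using word_dist_triangle[of "w i" "w' i" "w j"] word_dist_triangle[of "w' i" "w' j" "w j"] c by simp
    moreover have "d (w' i) (w' j) \<le> d (w' i) (w i) + d (w i) (w j) + d (w j) (w' j)"
      using word_dist_triangle[of "w' i" "w i" "w' j"] word_dist_triangle[of "w i" "w j" "w' j"] c by simp
    ultimately show ?thesis
      using w'(2)[OF ij(1)] w'(2)[OF ij(2)] word_dist_sym[of "w i" "w' i"] word_dist_sym[of "w j" "w' j"] c
      by linarith
  qed
  show ?thesis
  proof (rule quasigeodesic_seqI)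
    fix i j assume ij: "i \<le> j" "j \<le> n"
    then have i: "i \<le> n" by simp
    show "(real j - real i) / K - (\<epsilon> + 2 * R) \<le> d (w' i) (w' j)"
      using b[OF i ij(2)] D(4)[OF i ij(2)] ij by simp
    show "d (w' i) (w' j) \<le> K * (real j - real i) + (\<epsilon> + 2 * R)"
      using b[OF i ij(2)] D(5)[OF i ij(2)] ij by simp
  qed (use D R w' in auto)
qed

lemma quasigeodesic_seq_translate:
  assumes "quasigeodesic_seq K \<epsilon> n w" "g \<in> carrier G"
  shows "quasigeodesic_seq K \<epsilon> n (\<lambda>i. g \<otimes> w i)"
proof -
  note D = quasigeodesic_seqD[OF assms(1)]
  have "d (g \<otimes> w i) (g \<otimes> w j) = d (w i) (w j)" if "i \<le> n" "j \<le> n" for i j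
    using word_dist_left_mult[OF assms(2)] D(3) that by simp
  then show ?thesis using assms unfolding qi_embedding_def by auto
qed

lemma closest_index:
  fixes n :: nat
  shows "\<exists>k\<le>n. \<forall>i\<le>n. d (w k) z \<le> d (w i) z"
proof -
  have "Min ((\<lambda>i. d (w i) z) ` {..n}) \<in> (\<lambda>i. d (w i) z) ` {..n}" by (intro Min_in) auto
  then obtain k where "Min ((\<lambda>i. d (w i) z) ` {..n}) = d (w k) z" "k \<in> {..n}" by (rule imageE)
  then show ?thesis using Min_le[of "(\<lambda>i. d (w i) z) ` {..n}"] by (intro exI[of _ k]) auto
qed

text \<open>The basic construction of quasigeodesics: follow \<open>w\<close> up to the point \<open>w k\<close> closest to \<open>z\<close>, then
  go straight to \<open>z\<close>.  A point \<open>y\<close> at distance \<open>u\<close> along the second piece is still closest to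
  \<open>w k\<close>, so that each \<open>w i\<close> has distance at least \<open>u\<close> from \<open>y\<close>, and then \<open>d (w i) (w k)\<close> is at most
  twice the distance of \<open>w i\<close> and \<open>y\<close>.  Hence the length \<open>d (w i) (w k) + u\<close> of the detour is at most
  three times that distance, which is the source of the factor 3.\<close>

lemma quasigeodesic_seq_to_closest:
  assumes w: "quasigeodesic_seq K \<epsilon> n w" and z: "z \<in> carrier G" and k: "k \<le> n"
    and closest: "\<And>i. i \<le> n \<Longrightarrow> d (w k) z \<le> d (w i) z"
  shows "\<exists>m v. quasigeodesic_seq (3 * K) \<epsilon> (k + m) v \<and> (\<forall>i\<le>k. v i = w i) \<and> v (k + m) = z"
proof -
  note D = quasigeodesic_seqD[OF w]
  obtain m \<sigma> where m: "real m = d (w k) z" "geodesic_seq m \<sigma>" "\<sigma> 0 = w k" "\<sigma> m = z"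
    using geodesic_seq_exists[OF D(3)[OF k] z] by blast
  define v where "v i = (if i \<le> k then w i else \<sigma> (i - k))" for i
  have sc: "\<sigma> i \<in> carrier G" if "i \<le> m" for i using m(2) that unfolding geodesic_seq_def by auto
  have ds: "d (\<sigma> i) (\<sigma> j) = nat_dist i j" if "i \<le> m" "j \<le> m" for i j
    using m(2) that unfolding geodesic_seq_def by auto
  have v2: "v i = \<sigma> (i - k)" if "k \<le> i" for i using that m by (auto simp: v_def)
  have K3: "x / (3 * K) \<le> x / K" "x \<le> 3 * K * x" "K * x \<le> 3 * K * x" if "0 \<le> x" for x
  proof -
    show "x / (3 * K) \<le> x / K" using that D(1) by (intro divide_left_mono) auto
    have "1 * x \<le> (3 * K) * x" using that D(1) by (intro mult_right_mono) auto
    then show "x \<le> 3 * K * x" by simp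
    show "K * x \<le> 3 * K * x" using that D(1) by (intro mult_right_mono) auto
  qed
  have mixed: "real (k - i + u) / (3 * K) - \<epsilon> \<le> d (w i) (\<sigma> u)"
      "d (w i) (\<sigma> u) \<le> 3 * K * real (k - i + u) + \<epsilon>" if iu: "i \<le> k" "u \<le> m" for i u
  proof -
    have i: "i \<le> n" using iu k by simp
    have c: "w i \<in> carrier G" "w k \<in> carrier G" "\<sigma> u \<in> carrier G" using D(3) i k sc iu by auto
    have e: "d (w k) (\<sigma> u) = u" "d (\<sigma> u) z = m - u" using ds[of 0 u] ds[of u m] m iu by auto
    have "real m \<le> d (w i) (\<sigma> u) + d (\<sigma> u) z"
      using closest[OF i] m(1) word_dist_triangle[of "w i" "\<sigma> u" z] c z by simp
    then have far: "real u \<le> d (w i) (\<sigma> u)" using e iu by (simp add: of_nat_diff)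
    have "d (w i) (w k) \<le> d (w i) (\<sigma> u) + u"
      using word_dist_triangle[of "w i" "\<sigma> u" "w k"] c e word_dist_sym[of "\<sigma> u" "w k"] by simp
    moreover have lo: "real (k - i) / K - \<epsilon> \<le> d (w i) (w k)"
      using D(4)[OF i k] iu by (simp add: of_nat_diff)
    ultimately have "real (k - i) / K + real u - \<epsilon> \<le> 3 * d (w i) (\<sigma> u)" using far by simp
    moreover have "real u / K \<le> real u" using D(1) by (simp add: divide_le_eq mult_le_cancel_left1)
    ultimately have "real (k - i + u) / K - \<epsilon> \<le> 3 * d (w i) (\<sigma> u)" by (simp add: add_divide_distrib)
    then have "real (k - i + u) / K / 3 - \<epsilon> / 3 \<le> d (w i) (\<sigma> u)" by simp
    then show "real (k - i + u) / (3 * K) - \<epsilon> \<le> d (w i) (\<sigma> u)" using D(2) by (simp add: mult.commute)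
    have "d (w i) (\<sigma> u) \<le> K * real (k - i) + \<epsilon> + u"
      using word_dist_triangle[of "w i" "w k" "\<sigma> u"] c e D(5)[OF i k] iu by (simp add: of_nat_diff)
    then show "d (w i) (\<sigma> u) \<le> 3 * K * real (k - i + u) + \<epsilon>"
      using K3(3)[of "real (k - i)"] K3(2)[of "real u"] by (simp add: distrib_left)
  qed
  have "quasigeodesic_seq (3 * K) \<epsilon> (k + m) v"
  proof (rule quasigeodesic_seqI)
    fix i j assume ij: "i \<le> j" "j \<le> k + m"
    have "(real j - real i) / (3 * K) - \<epsilon> \<le> d (v i) (v j) \<and> d (v i) (v j) \<le> 3 * K * (real j - real i) + \<epsilon>"
    proof -
      consider "j \<le> k" | "i \<le> k" "k \<le> j" | "k \<le> i" using ij by linarith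
      then show ?thesis
      proof cases
        case 1
        then have "i \<le> n" "j \<le> n" using ij k by auto
        from D(4,5)[OF this] show ?thesis
          using 1 ij K3[of "real j - real i"] by (simp add: v_def)
      next
        case 2
        then show ?thesis using mixed[of i "j - k"] ij v2[of j] by (auto simp: v_def of_nat_diff)
      next
        case 3
        then have "d (v i) (v j) = real j - real i" using ds[of "i - k" "j - k"] v2 ij by auto
        moreover have "(real j - real i) / K \<le> real j - real i"
          using D(1) ij by (simp add: divide_le_eq mult_le_cancel_left1)
        ultimately show ?thesis using K3[of "real j - real i"] ij D(2) by simp
      qed
    qed
    then show "(real j - real i) / (3 * K) - \<epsilon> \<le> d (v i) (v j)"
      "d (v i) (v j) \<le> 3 * K * (real j - real i) + \<epsilon>" by auto
  qed (use D k sc in \<open>auto simp: v_def\<close>)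
  then show ?thesis using m v2[of "k + m"] by (intro exI[of _ m] exI[of _ v]) (auto simp: v_def)
qed

end

section \<open>Stable subgroups in terms of word metrics\<close>

text \<open>Stability in the form in which it is used: everything happens at vertices, paths are finite
  sequences, and the constants \<open>K0\<close>, \<open>\<epsilon>0\<close> compare the two word metrics.\<close>

locale stable_pair = word_metric G S + Sub: word_metric "G\<lparr>carrier := H\<rparr>" T
  for G (structure) and S H T +
  fixes K0 \<epsilon>0
  assumes sub: "subgroup H G"
    and const: "1 \<le> K0" "0 \<le> \<epsilon>0"
    and embedded: "\<And>x y. x \<in> H \<Longrightarrow> y \<in> H \<Longrightarrow>
      Sub.d x y / K0 - \<epsilon>0 \<le> d x y \<and> d x y \<le> K0 * Sub.d x y + \<epsilon>0"
    and stable: "\<And>K \<epsilon>. 1 \<le> K \<Longrightarrow> 0 \<le> \<epsilon> \<Longrightarrow>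
      \<exists>C. \<forall>n w m h. quasigeodesic_seq K \<epsilon> n w \<and> Sub.geodesic_seq m h \<and> w 0 = h 0 \<and> w n = h m
        \<longrightarrow> (\<forall>k\<le>n. \<exists>i\<le>m. d (w k) (h i) \<le> C)"

text \<open>A geodesic sequence of \<open>H\<close> is filled in to a geodesic of the Cayley graph of \<open>H\<close>, and a
  quasigeodesic sequence of \<open>G\<close> is read as a step function.  Stability then bounds the distance of
  \<open>w k\<close> from the image of a point of an edge of the geodesic, and this image is close to an endpoint
  of that edge.\<close>

lemma stable_subgroup_stable_pair:
  assumes "group G" and "stable_subgroup G H"
  shows "\<exists>S T K0 \<epsilon>0. stable_pair G S H T K0 \<epsilon>0"
proof -
  let ?H = "G\<lparr>carrier := H\<rparr>"
  obtain S T \<iota> K \<epsilon> f where sub: "subgroup H G" and S: "finite_generating_set G S"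
    and T: "finite_generating_set ?H T" and \<iota>: "\<forall>h\<in>H. \<iota> (vertex h) = vertex h"
    and qi: "qi_embedding K \<epsilon> (cayley_graph ?H T) (cayley_dist ?H T) (cayley_graph G S) (cayley_dist G S) \<iota>"
    and f: "\<And>I \<gamma>. geodesic (cayley_graph ?H T) (cayley_dist ?H T) I \<gamma> \<Longrightarrow>
           stable_quasigeodesic f (cayley_graph G S) (cayley_dist G S) I (\<iota> \<circ> \<gamma>)"
    using assms(2) unfolding stable_subgroup_def by blast
  interpret group G by fact
  interpret word_metric G S by unfold_locales (rule S)
  interpret HG: group ?H using subgroup.subgroup_is_group[OF sub \<open>group G\<close>] .
  interpret Sub: word_metric ?H T by unfold_locales (rule T)
  have HG: "H \<subseteq> carrier G" using sub by (simp add: subgroup.subset)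
  have K: "1 \<le> K" "0 \<le> \<epsilon>" using qi unfolding qi_embedding_def by auto
  have iota: "\<iota> p \<in> graph" if "p \<in> Sub.graph" for p using qi that unfolding qi_embedding_def by auto
  have up: "graph_dist (\<iota> p) (\<iota> q) \<le> K * Sub.graph_dist p q + \<epsilon>"
    and lo: "Sub.graph_dist p q / K - \<epsilon> \<le> graph_dist (\<iota> p) (\<iota> q)"
    if "p \<in> Sub.graph" "q \<in> Sub.graph" for p q using qi that unfolding qi_embedding_def by auto
  have vH: "vertex h \<in> Sub.graph" if "h \<in> H" for h using Sub.vertex_in_graph[of h] that by simp
  have emb: "Sub.d x y / K - \<epsilon> \<le> d x y \<and> d x y \<le> K * Sub.d x y + \<epsilon>" if "x \<in> H" "y \<in> H" for x y
  proof -
    have "graph_dist (\<iota> (vertex x)) (\<iota> (vertex y)) = d x y"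
      using \<iota> that HG graph_dist_vertices[of x y] by auto
    moreover have "Sub.graph_dist (vertex x) (vertex y) = Sub.d x y"
      using Sub.graph_dist_vertices[of x y] that by simp
    ultimately show ?thesis using up[OF vH vH, of x y] lo[OF vH vH, of x y] that by simp
  qed
  have stab: "\<exists>C. \<forall>n w m h. quasigeodesic_seq L e n w \<and> Sub.geodesic_seq m h \<and> w 0 = h 0 \<and> w n = h m
        \<longrightarrow> (\<forall>k\<le>n. \<exists>i\<le>m. d (w k) (h i) \<le> C)" if L: "1 \<le> L" "0 \<le> e" for L e
  proof (rule exI, intro allI impI)
    fix n w m h k
    assume A: "quasigeodesic_seq L e n w \<and> Sub.geodesic_seq m h \<and> w 0 = h 0 \<and> w n = h m"
      and k: "k \<le> n"
    then have w: "quasigeodesic_seq L e n w" and h: "Sub.geodesic_seq m h"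
      and ends: "w 0 = h 0" "w n = h m" by auto
    define \<gamma> where "\<gamma> = Sub.polygonal_path m h"
    define \<eta> :: "real \<Rightarrow> 'a \<Rightarrow> real" where "\<eta> t = vertex (w (nat \<lfloor>t\<rfloor>))" for t
    have hH: "h i \<in> H" if "i \<le> m" for i using h that unfolding Sub.geodesic_seq_def by auto
    have st: "stable_quasigeodesic f graph graph_dist {0..real m} (\<iota> \<circ> \<gamma>)"
      unfolding \<gamma>_def by (rule f[OF Sub.polygonal_path_geodesic[OF h]])
    have \<eta>: "quasigeodesic L (e + L) graph graph_dist {0..real n} \<eta>"
      unfolding \<eta>_def by (rule step_path_quasigeodesic[OF w])
    have \<gamma>v: "\<gamma> (real i) = vertex (h i)" if "i \<le> m" for i
      unfolding \<gamma>_def by (rule Sub.polygonal_path_vertex[OF h that])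
    have "\<eta> 0 = (\<iota> \<circ> \<gamma>) (real 0)" "\<eta> (real n) = (\<iota> \<circ> \<gamma>) (real m)"
      unfolding \<eta>_def o_apply \<gamma>v[OF le0] \<gamma>v[OF le_refl] using ends \<iota> hH by auto
    then have "\<eta> 0 \<in> (\<iota> \<circ> \<gamma>) ` {0..real m}" "\<eta> (real n) \<in> (\<iota> \<circ> \<gamma>) ` {0..real m}"
      by (metis atLeastAtMost_iff image_eqI of_nat_0 of_nat_0_le_iff order_refl)+
    moreover note conjunct2[OF st[unfolded stable_quasigeodesic_def], rule_format,
        of L "e + L" 0 "real n" \<eta> "real k"]
    moreover have "real k \<in> {0..real n}" "0 \<le> e + L" using k L by auto
    ultimately obtain s where s: "s \<in> {0..real m}" "graph_dist (\<eta> (real k)) (\<iota> (\<gamma> s)) \<le> f L (e + L)"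
      using L \<eta> by auto
    \<comment> \<open>The vertex \<open>h i\<close> supports \<open>\<gamma> s\<close>, hence has distance at most 1 from it in the Cayley graph of \<open>H\<close>.\<close>
    define i where "i = nat \<lfloor>s\<rfloor>"
    have i: "i \<le> m" "\<bar>s - real i\<bar> < 1" using s(1) unfolding i_def by (simp_all, linarith+)
    have g: "\<gamma> s \<in> Sub.graph" unfolding \<gamma>_def by (rule Sub.polygonal_path_in_graph[OF h]) (use s in auto)
    have nz: "\<gamma> s (h i) > 0" unfolding \<gamma>_def using Sub.polygonal_path_at[OF h i(1), of s] i(2) by simp
    then have "Sub.graph_dist (vertex (h i)) (\<gamma> s) \<le> 1"
      using Sub.graph_dist_vertex_support[OF g, of "h i"] by simp
    then have "K * Sub.graph_dist (vertex (h i)) (\<gamma> s) \<le> K"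
      using K mult_left_mono[of "Sub.graph_dist (vertex (h i)) (\<gamma> s)" 1 K] by simp
    then have "graph_dist (vertex (h i)) (\<iota> (\<gamma> s)) \<le> K + \<epsilon>"
      using up[OF vH g, of "h i"] hH[OF i(1)] \<iota> by simp
    then have "graph_dist (\<iota> (\<gamma> s)) (vertex (h i)) \<le> K + \<epsilon>"
      using graph_dist_sym[OF iota[OF g] vertex_in_graph, of "h i"] hH[OF i(1)] HG by auto
    moreover have "graph_dist (vertex (w k)) (\<iota> (\<gamma> s)) \<le> f L (e + L)" using s(2) unfolding \<eta>_def by simp
    moreover have "d (w k) (h i) \<le> graph_dist (vertex (w k)) (\<iota> (\<gamma> s)) + graph_dist (\<iota> (\<gamma> s)) (vertex (h i))"
      using word_dist_le_via_point[OF _ _ iota[OF g]] quasigeodesic_seqD(3)[OF w k] hH[OF i(1)] HG by blast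
    ultimately have "d (w k) (h i) \<le> f L (e + L) + K + \<epsilon>" by linarith
    then show "\<exists>i\<le>m. d (w k) (h i) \<le> f L (e + L) + K + \<epsilon>" using i(1) by blast
  qed
  have "stable_pair G S H T K \<epsilon>"
    by (intro stable_pair.intro stable_pair_axioms.intro word_metric_axioms Sub.word_metric_axioms
        sub K emb stab) auto
  then show ?thesis by blast
qed

section \<open>Hyperbolicity and cosets of stable subgroups\<close>

context stable_pair begin

abbreviation dH where "dH \<equiv> Sub.d"

lemma H_carrier: "h \<in> H \<Longrightarrow> h \<in> carrier G"
  using sub by (rule subgroup.mem_carrier)

lemma H_mult: "h \<in> H \<Longrightarrow> k \<in> H \<Longrightarrow> h \<otimes> k \<in> H"
  using sub by (rule subgroup.m_closed)

lemma H_inv: "h \<in> H \<Longrightarrow> inv h \<in> H"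
  using sub by (rule subgroup.m_inv_closed)

lemma H_one: "\<one> \<in> H"
  using sub by (rule subgroup.one_closed)

lemmas dH_sym = Sub.word_dist_sym[simplified]
lemmas dH_triangle = Sub.word_dist_triangle[simplified]
lemmas dH_left_mult = Sub.word_dist_left_mult[simplified]
lemmas H_geodesic_exists = Sub.geodesic_seq_exists[simplified]

lemma between_H: "Sub.between a v b \<Longrightarrow> a \<in> H \<and> v \<in> H \<and> b \<in> H"
  unfolding Sub.between_def by simp

lemma between_eq: "Sub.between a v b \<Longrightarrow> dH a v + dH v b = dH a b"
  unfolding Sub.between_def by simp

lemma geodesic_seq_H: "Sub.geodesic_seq n \<sigma> \<Longrightarrow> i \<le> n \<Longrightarrow> \<sigma> i \<in> H"
  unfolding Sub.geodesic_seq_def by auto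

lemma d_le_dH: "x \<in> H \<Longrightarrow> y \<in> H \<Longrightarrow> d x y \<le> K0 * dH x y + \<epsilon>0"
  using embedded by blast

lemma dH_le_d:
  assumes "x \<in> H" "y \<in> H" shows "dH x y \<le> K0 * (d x y + \<epsilon>0)"
proof -
  have "dH x y / K0 \<le> d x y + \<epsilon>0" using embedded[OF assms] by linarith
  then show ?thesis using const(1) by (simp add: divide_le_eq mult.commute)
qed

lemma H_geodesic_quasigeodesic:
  assumes "Sub.geodesic_seq n \<sigma>" shows "quasigeodesic_seq K0 \<epsilon>0 n \<sigma>"
proof (rule quasigeodesic_seqI)
  fix i j assume ij: "i \<le> j" "j \<le> n"
  then have "dH (\<sigma> i) (\<sigma> j) = real j - real i" using assms unfolding Sub.geodesic_seq_def by auto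
  moreover have "\<sigma> i \<in> H" "\<sigma> j \<in> H" using geodesic_seq_H[OF assms] ij by auto
  ultimately show "(real j - real i) / K0 - \<epsilon>0 \<le> d (\<sigma> i) (\<sigma> j)"
      "d (\<sigma> i) (\<sigma> j) \<le> K0 * (real j - real i) + \<epsilon>0" using embedded by metis+
qed (use const geodesic_seq_H[OF assms] H_carrier in auto)

lemma stability_constant:
  assumes "1 \<le> K" "0 \<le> \<epsilon>"
  obtains C where "\<And>n w m h k. quasigeodesic_seq K \<epsilon> n w \<Longrightarrow> Sub.geodesic_seq m h \<Longrightarrow>
    w 0 = h 0 \<Longrightarrow> w n = h m \<Longrightarrow> k \<le> n \<Longrightarrow> \<exists>i\<le>m. d (w k) (h i) \<le> C"
proof -
  from stable[OF assms] obtain C where C: "\<forall>n w m h. quasigeodesic_seq K \<epsilon> n w \<and>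
    Sub.geodesic_seq m h \<and> w 0 = h 0 \<and> w n = h m \<longrightarrow> (\<forall>k\<le>n. \<exists>i\<le>m. d (w k) (h i) \<le> C)" ..
  show thesis by (rule that[of C]) (rule C[rule_format], auto)
qed

text \<open>The set of all \<open>v\<close> in \<open>H\<close> with \<open>near R g v\<close>, the part of \<open>H\<close> that lies within \<open>R\<close> of the coset
  \<open>gH\<close>, is called the trace of \<open>gH\<close> of radius \<open>R\<close> below.\<close>

definition near :: "real \<Rightarrow> 'a \<Rightarrow> 'a \<Rightarrow> bool" where
  "near R g v \<longleftrightarrow> (\<exists>h\<in>H. d v (g \<otimes> h) \<le> R)"

lemma near_mono: "near R g v \<Longrightarrow> R \<le> R' \<Longrightarrow> near R' g v"
  unfolding near_def by (meson order_trans)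

lemma near_translate:
  assumes "near R g v" "a \<in> carrier G" "g \<in> carrier G" "v \<in> carrier G"
  shows "near R (a \<otimes> g) (a \<otimes> v)"
proof -
  obtain h where h: "h \<in> H" "d v (g \<otimes> h) \<le> R" using assms(1) near_def by blast
  then have "d (a \<otimes> v) (a \<otimes> g \<otimes> h) \<le> R"
    using word_dist_left_mult[of a v "g \<otimes> h"] assms H_carrier[OF h(1)] by (simp add: m_assoc)
  then show ?thesis unfolding near_def using h(1) by blast
qed

lemma near_trans:
  assumes "near R g v" "d u v \<le> r" "g \<in> carrier G" "v \<in> carrier G" "u \<in> carrier G"
  shows "near (R + r) g u"
proof -
  obtain h where h: "h \<in> H" "d v (g \<otimes> h) \<le> R" using assms(1) near_def by blast
  then have "d u (g \<otimes> h) \<le> R + r"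
    using word_dist_triangle[of u v "g \<otimes> h"] assms H_carrier[OF h(1)] by simp
  then show ?thesis unfolding near_def using h(1) by blast
qed

lemma near_representative:
  assumes "g \<in> carrier G" "h \<in> H" shows "near R (g \<otimes> h) v \<longleftrightarrow> near R g v"
proof
  assume "near R (g \<otimes> h) v"
  then obtain k where k: "k \<in> H" "d v (g \<otimes> h \<otimes> k) \<le> R" unfolding near_def by blast
  then have "d v (g \<otimes> (h \<otimes> k)) \<le> R" using assms H_carrier by (simp add: m_assoc)
  then show "near R g v" unfolding near_def using H_mult[OF assms(2) k(1)] by blast
next
  assume "near R g v"
  then obtain k where k: "k \<in> H" "d v (g \<otimes> k) \<le> R" unfolding near_def by blast
  have "g \<otimes> h \<otimes> (inv h \<otimes> k) = g \<otimes> k"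
    using assms k H_carrier by (metis inv_closed inv_solve_left m_assoc m_closed)
  then have "d v (g \<otimes> h \<otimes> (inv h \<otimes> k)) \<le> R" using k by simp
  then show "near R (g \<otimes> h) v" unfolding near_def using H_mult[OF H_inv[OF assms(2)] k(1)] by blast
qed

text \<open>Moving the two ends onto the coset \<open>gH\<close> only enlarges the additive constant, and translating by
  the inverse of \<open>g\<close> puts the ends into \<open>H\<close>, where stability applies.\<close>

lemma quasigeodesic_near_coset:
  assumes "1 \<le> K" "0 \<le> \<epsilon>" "0 \<le> R"
  obtains C where "R \<le> C" "\<And>g n w k. g \<in> carrier G \<Longrightarrow> quasigeodesic_seq K \<epsilon> n w \<Longrightarrow>
    near R g (w 0) \<Longrightarrow> near R g (w n) \<Longrightarrow> k \<le> n \<Longrightarrow> near C g (w k)"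
proof -
  obtain C where C: "\<And>n w m h k. quasigeodesic_seq K (\<epsilon> + 2 * R) n w \<Longrightarrow> Sub.geodesic_seq m h \<Longrightarrow>
      w 0 = h 0 \<Longrightarrow> w n = h m \<Longrightarrow> k \<le> n \<Longrightarrow> \<exists>i\<le>m. d (w k) (h i) \<le> C"
    using stability_constant[of K "\<epsilon> + 2 * R"] assms by auto
  have "near (R + \<bar>C\<bar>) g (w k)" if g: "g \<in> carrier G" and w: "quasigeodesic_seq K \<epsilon> n w"
    and ends: "near R g (w 0)" "near R g (w n)" and k: "k \<le> n" for g n w k
  proof (cases "n = 0")
    case True
    then show ?thesis using ends k near_mono by fastforce
  next
    case False
    note D = quasigeodesic_seqD[OF w]
    obtain a b where ab: "a \<in> H" "d (w 0) (g \<otimes> a) \<le> R" "b \<in> H" "d (w n) (g \<otimes> b) \<le> R"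
      using ends unfolding near_def by blast
    \<comment> \<open>For \<open>n = 0\<close> both ends would compete for one index, hence the case distinction.\<close>
    define w' where "w' i = (if i = 0 then g \<otimes> a else if i = n then g \<otimes> b else w i)" for i
    have w'c: "w' i \<in> carrier G" "d (w i) (w' i) \<le> R" if "i \<le> n" for i
      using that D(3) ab g H_carrier word_dist_self assms(3) by (auto simp: w'_def)
    define u where "u i = inv g \<otimes> w' i" for i
    have u: "quasigeodesic_seq K (\<epsilon> + 2 * R) n u" unfolding u_def
      by (rule quasigeodesic_seq_translate[OF quasigeodesic_seq_perturb[OF w assms(3)]]) (use w'c g in auto)
    have u0: "u 0 = a" "u n = b" using ab g H_carrier False
      by (auto simp: u_def w'_def m_assoc[symmetric])
    obtain m h where h: "Sub.geodesic_seq m h" "h 0 = a" "h m = b"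
      using H_geodesic_exists[OF ab(1,3)] by blast
    obtain i where i: "i \<le> m" "d (u k) (h i) \<le> C" using C[OF u h(1) _ _ k] u0 h by auto
    have hi: "h i \<in> H" using geodesic_seq_H[OF h(1) i(1)] .
    have "g \<otimes> u k = w' k" unfolding u_def using g w'c(1)[OF k] by (simp add: m_assoc[symmetric])
    then have "d (w' k) (g \<otimes> h i) \<le> C"
      using word_dist_left_mult[OF g, of "u k" "h i"] i(2) quasigeodesic_seqD(3)[OF u k] H_carrier[OF hi] by simp
    then have "near C g (w' k)" unfolding near_def using hi by blast
    then have "near (C + R) g (w k)" using near_trans[OF _ w'c(2)[OF k] g w'c(1)[OF k] D(3)[OF k]] by simp
    then show ?thesis by (rule near_mono) simp
  qed
  then show thesis using that[of "R + \<bar>C\<bar>"] by simp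
qed

text \<open>Stability makes \<open>H\<close> hyperbolic: let \<open>\<sigma> l\<close> be the point of the side from \<open>a\<close> to \<open>b\<close> that is closest
  in \<open>G\<close> to the vertex \<open>c\<close>.  The side up to \<open>\<sigma> l\<close>, continued straight to \<open>c\<close>, is a quasigeodesic from
  \<open>a\<close> to \<open>c\<close>, so it stays close to the side from \<open>a\<close> to \<open>c\<close>.  The remaining part of the first side
  is treated in the same way, read backwards from \<open>b\<close>.\<close>

lemma thin_triangles:
  obtains \<delta> where "0 \<le> \<delta>" "\<And>a v b c. Sub.between a v b \<Longrightarrow> c \<in> H \<Longrightarrow>
    (\<exists>s. Sub.between a s c \<and> dH v s \<le> \<delta>) \<or> (\<exists>s. Sub.between b s c \<and> dH v s \<le> \<delta>)"
proof -
  obtain C where C: "\<And>n w m h k. quasigeodesic_seq (3 * K0) \<epsilon>0 n w \<Longrightarrow> Sub.geodesic_seq m h \<Longrightarrow>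
      w 0 = h 0 \<Longrightarrow> w n = h m \<Longrightarrow> k \<le> n \<Longrightarrow> \<exists>i\<le>m. d (w k) (h i) \<le> C"
    using stability_constant[of "3 * K0" \<epsilon>0] const by auto
  define \<delta> where "\<delta> = K0 * (\<bar>C\<bar> + \<epsilon>0)"
  have before: "\<exists>s. Sub.between (\<sigma> 0) s c \<and> dH (\<sigma> k) s \<le> \<delta>"
    if \<sigma>: "Sub.geodesic_seq n \<sigma>" and c: "c \<in> H" and l: "l \<le> n" "\<And>i. i \<le> n \<Longrightarrow> d (\<sigma> l) c \<le> d (\<sigma> i) c"
      and kl: "k \<le> l" for n \<sigma> c l k
  proof -
    note q = H_geodesic_quasigeodesic[OF \<sigma>]
    obtain m v where v: "quasigeodesic_seq (3 * K0) \<epsilon>0 (l + m) v" "\<forall>i\<le>l. v i = \<sigma> i" "v (l + m) = c"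
      using quasigeodesic_seq_to_closest[OF q H_carrier[OF c] l] by blast
    have \<sigma>0: "\<sigma> 0 \<in> H" by (rule geodesic_seq_H[OF \<sigma>]) simp
    have \<sigma>k: "\<sigma> k \<in> H" by (rule geodesic_seq_H[OF \<sigma>]) (use kl l in simp)
    obtain p h where h: "Sub.geodesic_seq p h" "h 0 = \<sigma> 0" "h p = c" using H_geodesic_exists[OF \<sigma>0 c] by blast
    have "k \<le> l + m" "v 0 = h 0" "v (l + m) = h p" using kl v(2,3) h(2,3) by auto
    then obtain i where i: "i \<le> p" "d (v k) (h i) \<le> C" using C[OF v(1) h(1)] by blast
    have "dH (\<sigma> k) (h i) \<le> K0 * (d (\<sigma> k) (h i) + \<epsilon>0)" by (rule dH_le_d[OF \<sigma>k geodesic_seq_H[OF h(1) i(1)]])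
    also have "\<dots> \<le> \<delta>" unfolding \<delta>_def using i v(2) kl const by (intro mult_left_mono) auto
    finally show ?thesis using Sub.geodesic_seq_between[OF h(1) i(1)] h by auto
  qed
  show thesis
  proof (rule that[of \<delta>])
    show "0 \<le> \<delta>" unfolding \<delta>_def using const by simp
    fix a v b c assume bt: "Sub.between a v b" and c: "c \<in> H"
    obtain n \<sigma> k where \<sigma>: "Sub.geodesic_seq n \<sigma>" "\<sigma> 0 = a" "\<sigma> n = b" and k: "k \<le> n" "\<sigma> k = v"
      using Sub.geodesic_seq_through[OF bt] by blast
    obtain l where l: "l \<le> n" "\<And>i. i \<le> n \<Longrightarrow> d (\<sigma> l) c \<le> d (\<sigma> i) c" using closest_index by blast
    show "(\<exists>s. Sub.between a s c \<and> dH v s \<le> \<delta>) \<or> (\<exists>s. Sub.between b s c \<and> dH v s \<le> \<delta>)"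
    proof (cases "k \<le> l")
      case True
      show ?thesis using before[OF \<sigma>(1) c l True] unfolding \<sigma>(2) k(2) ..
    next
      case False
      have "\<exists>s. Sub.between (\<sigma> (n - 0)) s c \<and> dH (\<sigma> (n - (n - k))) s \<le> \<delta>"
        by (rule before[OF Sub.geodesic_seq_rev[OF \<sigma>(1)] c, of "n - l"]) (use l False in auto)
      moreover have "n - 0 = n" "n - (n - k) = k" using k(1) by auto
      ultimately have "\<exists>s. Sub.between b s c \<and> dH v s \<le> \<delta>" by (simp only: \<sigma>(3) k(2))
      then show ?thesis ..
    qed
  qed
qed

text \<open>If \<open>H\<close>, \<open>xH\<close> and \<open>yH\<close> are pairwise close, then the traces of \<open>xH\<close> and \<open>yH\<close> meet: join a point of
  \<open>H\<close> near \<open>xH\<close> to a point of \<open>H\<close> near \<open>yH\<close> by a geodesic of \<open>H\<close>, and let \<open>p\<close> be its point closest in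
  \<open>G\<close> to a point \<open>z\<close> of \<open>xH\<close> near \<open>yH\<close>.  Each half of the geodesic, continued from \<open>p\<close> straight to
  \<open>z\<close>, is a quasigeodesic with both ends near one of the two cosets, and \<open>p\<close> lies on both.\<close>

lemma close_to_two_cosets:
  assumes "0 \<le> D"
  obtains R where "D \<le> R" "\<And>x y a b h. x \<in> carrier G \<Longrightarrow> y \<in> carrier G \<Longrightarrow> a \<in> H \<Longrightarrow> near D x a \<Longrightarrow>
    b \<in> H \<Longrightarrow> near D y b \<Longrightarrow> h \<in> H \<Longrightarrow> near D y (x \<otimes> h) \<Longrightarrow> \<exists>p\<in>H. near R x p \<and> near R y p"
proof -
  obtain C where C: "D \<le> C" "\<And>g n w k. g \<in> carrier G \<Longrightarrow> quasigeodesic_seq (3 * K0) \<epsilon>0 n w \<Longrightarrow>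
    near D g (w 0) \<Longrightarrow> near D g (w n) \<Longrightarrow> k \<le> n \<Longrightarrow> near C g (w k)"
    using quasigeodesic_near_coset[of "3 * K0" \<epsilon>0 D] const assms by auto
  have before: "near C g (\<sigma> l)"
    if \<sigma>: "Sub.geodesic_seq n \<sigma>" and z: "z \<in> carrier G"
      and l: "l \<le> n" "\<And>i. i \<le> n \<Longrightarrow> d (\<sigma> l) z \<le> d (\<sigma> i) z"
      and g: "g \<in> carrier G" and ng: "near D g (\<sigma> 0)" "near D g z" for n \<sigma> z l g
  proof -
    obtain m v where v: "quasigeodesic_seq (3 * K0) \<epsilon>0 (l + m) v" "\<forall>i\<le>l. v i = \<sigma> i" "v (l + m) = z"
      using quasigeodesic_seq_to_closest[OF H_geodesic_quasigeodesic[OF \<sigma>] z l] by blast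
    then show ?thesis using C(2)[OF g v(1), of l] ng by simp
  qed
  have "\<exists>p\<in>H. near C x p \<and> near C y p" if xy: "x \<in> carrier G" "y \<in> carrier G"
    and a: "a \<in> H" "near D x a" and b: "b \<in> H" "near D y b" and h: "h \<in> H" "near D y (x \<otimes> h)" for x y a b h
  proof -
    have z: "x \<otimes> h \<in> carrier G" using xy h H_carrier by simp
    have zx: "near D x (x \<otimes> h)" unfolding near_def using h(1) word_dist_self[OF z] assms by (intro bexI[of _ h]) auto
    obtain n \<sigma> where \<sigma>: "Sub.geodesic_seq n \<sigma>" "\<sigma> 0 = a" "\<sigma> n = b" using H_geodesic_exists[OF a(1) b(1)] by blast
    obtain l where l: "l \<le> n" "\<And>i. i \<le> n \<Longrightarrow> d (\<sigma> l) (x \<otimes> h) \<le> d (\<sigma> i) (x \<otimes> h)"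
      using closest_index by blast
    have "near C x (\<sigma> l)" using before[OF \<sigma>(1) z l xy(1)] zx a \<sigma> by simp
    moreover have "near C y (\<sigma> (n - (n - l)))"
      by (rule before[OF Sub.geodesic_seq_rev[OF \<sigma>(1)] z _ _ xy(2)]) (use l b h \<sigma> in auto)
    moreover have "n - (n - l) = l" using l(1) by simp
    ultimately show ?thesis using geodesic_seq_H[OF \<sigma>(1) l(1)] by metis
  qed
  then show thesis using that[of C] C(1) by blast
qed

text \<open>Geodesics of \<open>H\<close> are quasigeodesics of \<open>G\<close>, so they stay near a coset if their ends do.\<close>

lemma traces_quasiconvex:
  assumes "0 \<le> R"
  obtains R' where "0 \<le> R'" "\<And>x a v b. x \<in> carrier G \<Longrightarrow> near R x a \<Longrightarrow> near R x b \<Longrightarrow>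
    Sub.between a v b \<Longrightarrow> near R' x v"
proof -
  obtain C where C: "R \<le> C" "\<And>g n w k. g \<in> carrier G \<Longrightarrow> quasigeodesic_seq K0 \<epsilon>0 n w \<Longrightarrow>
    near R g (w 0) \<Longrightarrow> near R g (w n) \<Longrightarrow> k \<le> n \<Longrightarrow> near C g (w k)"
    using quasigeodesic_near_coset[of K0 \<epsilon>0 R] const assms by auto
  show thesis
  proof (rule that[of C])
    show "0 \<le> C" using C(1) assms by simp
    fix x a v b assume x: "x \<in> carrier G" and ab: "near R x a" "near R x b"
      and bt: "Sub.between a v b"
    obtain n \<sigma> k where \<sigma>: "Sub.geodesic_seq n \<sigma>" "\<sigma> 0 = a" "\<sigma> n = b" and k: "k \<le> n" "\<sigma> k = v"
      using Sub.geodesic_seq_through[OF bt] by blast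
    have "near C x (\<sigma> k)"
      by (rule C(2)[OF x H_geodesic_quasigeodesic[OF \<sigma>(1)] _ _ k(1)]) (simp_all add: \<sigma> ab)
    then show "near C x v" by (simp only: k(2))
  qed
qed

section \<open>Bounded packing\<close>

text \<open>Enlarging the radius enlarges a nonempty trace only by a bounded amount.  Up to translation by
  an element of \<open>H\<close>, a coset with a point near \<open>v\<close> is one of the finitely many \<open>bH\<close> with \<open>b\<close> in a
  ball, and each of these contributes one distance.\<close>

lemma trace_of_larger_radius:
  obtains r where "0 \<le> r" "\<And>x v u. x \<in> carrier G \<Longrightarrow> v \<in> H \<Longrightarrow> near R' x v \<Longrightarrow> u \<in> H \<Longrightarrow> near R x u \<Longrightarrow>
    \<exists>u'\<in>H. near R x u' \<and> dH v u' \<le> r"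
proof -
  define B where "B = {g \<in> carrier G. d \<one> g \<le> R'}"
  have fB: "finite B" unfolding B_def by (rule finite_ball)
  \<comment> \<open>For \<open>b\<close> with empty trace the value of \<open>f\<close> is arbitrary; it only makes the bound \<open>r\<close> larger.\<close>
  define f where "f b = (SOME u. u \<in> H \<and> near R b u)" for b
  define r where "r = Max (insert 0 ((\<lambda>b. dH \<one> (f b)) ` B))"
  have r: "0 \<le> r" "b \<in> B \<Longrightarrow> dH \<one> (f b) \<le> r" for b
    unfolding r_def using fB by (auto intro!: Max_ge)
  have "\<exists>u'\<in>H. near R x u' \<and> dH v u' \<le> r" if x: "x \<in> carrier G" and v: "v \<in> H" "near R' x v"
    and u: "u \<in> H" "near R x u" for x v u
  proof -
    obtain h where h: "h \<in> H" "d v (x \<otimes> h) \<le> R'" using v near_def by blast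
    note c = x H_carrier[OF v(1)] H_carrier[OF u(1)] H_carrier[OF h(1)]
    define b where "b = inv v \<otimes> x \<otimes> h"
    have bc: "b \<in> carrier G" unfolding b_def using c by simp
    have vb: "v \<otimes> b = x \<otimes> h" unfolding b_def using c by (simp add: m_assoc[symmetric])
    have "d \<one> b = d v (x \<otimes> h)" using word_dist_left_mult[of v \<one> b] c bc vb by simp
    then have bB: "b \<in> B" using h bc unfolding B_def by simp
    have "near R (inv v \<otimes> x) (inv v \<otimes> u)" by (rule near_translate[OF u(2)]) (use c in auto)
    then have "near R b (inv v \<otimes> u)" unfolding b_def using near_representative[OF _ h(1)] c by simp
    then have "inv v \<otimes> u \<in> H \<and> near R b (inv v \<otimes> u)" using H_mult[OF H_inv[OF v(1)] u(1)] by simp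
    then have f: "f b \<in> H \<and> near R b (f b)" unfolding f_def by (rule someI)
    then have fH: "f b \<in> H" by simp
    have "near R (v \<otimes> b) (v \<otimes> f b)" by (rule near_translate) (use f c bc H_carrier in auto)
    then have "near R x (v \<otimes> f b)" unfolding vb using near_representative[OF x h(1)] by simp
    moreover have "dH v (v \<otimes> f b) = dH \<one> (f b)" using dH_left_mult[OF v(1) H_one fH] c by simp
    ultimately show ?thesis using r(2)[OF bB] H_mult[OF v(1) fH] by auto
  qed
  then show thesis using that[of r] r(1) by blast
qed

text \<open>If \<open>p\<close> is a point of a trace closest to the identity, then any geodesic from the identity to
  another point \<open>w\<close> of the trace passes close to \<open>p\<close>.  Otherwise the point \<open>v\<close> at distance \<open>t\<close> from \<open>p\<close>
  on the way to \<open>w\<close>, which is close to the trace by quasiconvexity, would by thinness be close to a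
  geodesic from \<open>p\<close> to the identity, and the trace would have a point closer to the identity.\<close>

lemma projection_on_geodesic:
  assumes R: "0 \<le> R"
  obtains c where "0 \<le> c" "\<And>x p w. x \<in> carrier G \<Longrightarrow> p \<in> H \<Longrightarrow> near R x p \<Longrightarrow> w \<in> H \<Longrightarrow> near R x w \<Longrightarrow>
    (\<And>u. u \<in> H \<Longrightarrow> near R x u \<Longrightarrow> dH \<one> p \<le> dH \<one> u) \<Longrightarrow> \<exists>q. Sub.between \<one> q w \<and> dH p q \<le> c"
proof -
  obtain \<delta> where \<delta>: "0 \<le> \<delta>" "\<And>a v b c. Sub.between a v b \<Longrightarrow> c \<in> H \<Longrightarrow>
    (\<exists>s. Sub.between a s c \<and> dH v s \<le> \<delta>) \<or> (\<exists>s. Sub.between b s c \<and> dH v s \<le> \<delta>)"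
    using thin_triangles by blast
  obtain R' where R': "0 \<le> R'" "\<And>x a v b. x \<in> carrier G \<Longrightarrow> near R x a \<Longrightarrow> near R x b \<Longrightarrow>
    Sub.between a v b \<Longrightarrow> near R' x v" using traces_quasiconvex[OF R] by blast
  obtain r where r: "0 \<le> r" "\<And>x v u. x \<in> carrier G \<Longrightarrow> v \<in> H \<Longrightarrow> near R' x v \<Longrightarrow> u \<in> H \<Longrightarrow> near R x u \<Longrightarrow>
    \<exists>u'\<in>H. near R x u' \<and> dH v u' \<le> r" using trace_of_larger_radius[of R' R] by blast
  obtain t :: nat where t: "r + 2 * \<delta> < real t" using reals_Archimedean2 by blast
  have "\<exists>q. Sub.between \<one> q w \<and> dH p q \<le> real t + \<delta>"
    if x: "x \<in> carrier G" and p: "p \<in> H" "near R x p" and w: "w \<in> H" "near R x w"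
      and closest: "\<And>u. u \<in> H \<Longrightarrow> near R x u \<Longrightarrow> dH \<one> p \<le> dH \<one> u" for x p w
  proof (cases "dH p w \<le> real t")
    case True
    have "Sub.between \<one> w w" unfolding Sub.between_def using w(1) H_one Sub.word_dist_self[of w] by simp
    then show ?thesis using True \<delta>(1) by (intro exI[of _ w]) simp
  next
    case False
    obtain n \<sigma> where \<sigma>: "real n = dH p w" "Sub.geodesic_seq n \<sigma>" "\<sigma> 0 = p" "\<sigma> n = w"
      using H_geodesic_exists[OF p(1) w(1)] by blast
    have tn: "t \<le> n" using False \<sigma>(1) by simp
    define v where "v = \<sigma> t"
    have bt: "Sub.between p v w" using Sub.geodesic_seq_between[OF \<sigma>(2) tn] \<sigma> unfolding v_def by simp
    then have v: "v \<in> H" using between_H by blast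
    have pv: "dH p v = real t" using \<sigma>(2,3) tn unfolding Sub.geodesic_seq_def v_def by force
    obtain u where u: "u \<in> H" "near R x u" "dH v u \<le> r"
      using r(2)[OF x v R'(2)[OF x p(2) w(2) bt] w] by blast
    have far: "dH \<one> p \<le> dH \<one> v + r"
      using closest[OF u(1,2)] dH_triangle[OF H_one v u(1)] u(3) by linarith
    consider s where "Sub.between p s \<one>" "dH v s \<le> \<delta>" | s where "Sub.between w s \<one>" "dH v s \<le> \<delta>"
      using \<delta>(2)[OF bt H_one] by blast
    then show ?thesis
    proof cases
      case 1
      have s: "s \<in> H" using between_H 1 by blast
      have "dH p s + dH s \<one> = dH p \<one>" using between_eq[OF 1(1)] .
      moreover have "dH \<one> v \<le> dH \<one> s + dH s v" by (rule dH_triangle[OF H_one s v])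
      moreover have "dH p v \<le> dH p s + dH s v" by (rule dH_triangle[OF p(1) s v])
      ultimately have "real t \<le> r + 2 * \<delta>"
        using far pv 1(2) dH_sym[OF s v] dH_sym[OF s H_one] dH_sym[OF p(1) H_one] by linarith
      then show ?thesis using t by simp
    next
      case 2
      have s: "s \<in> H" using between_H 2 by blast
      have "dH p s \<le> real t + \<delta>" using dH_triangle[OF p(1) v s] pv 2(2) by linarith
      then show ?thesis using 2(1) Sub.between_sym by blast
    qed
  qed
  then show thesis using that[of "real t + \<delta>"] \<delta>(1) by simp
qed

lemma closest_point_in_trace:
  assumes "p0 \<in> H" "near R x p0"
  shows "\<exists>p\<in>H. near R x p \<and> (\<forall>u\<in>H. near R x u \<longrightarrow> dH \<one> p \<le> dH \<one> u)"
proof -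
  obtain p where "p \<in> H \<and> near R x p"
    "\<forall>u. u \<in> H \<and> near R x u \<longrightarrow>
      word_length (G\<lparr>carrier := H\<rparr>) T (inv\<^bsub>G\<lparr>carrier := H\<rparr>\<^esub> \<one> \<otimes> p)
      \<le> word_length (G\<lparr>carrier := H\<rparr>) T (inv\<^bsub>G\<lparr>carrier := H\<rparr>\<^esub> \<one> \<otimes> u)"
    using ex_has_least_nat[of "\<lambda>p. p \<in> H \<and> near R x p" p0
      "\<lambda>p. word_length (G\<lparr>carrier := H\<rparr>) T (inv\<^bsub>G\<lparr>carrier := H\<rparr>\<^esub> \<one> \<otimes> p)"] assms by blast
  then show ?thesis unfolding word_dist_def by auto
qed

text \<open>As for subtrees of a rooted tree: pairwise intersecting traces come close to a common point,
  namely the point of some trace that is closest to the identity, if the trace is chosen so that this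
  point \<open>p x\<close> is as far from the identity as possible.  Given another trace, of \<open>yH\<close>, and a common
  point \<open>w\<close>, a geodesic from the identity to \<open>w\<close> passes close to \<open>p x\<close>, and by thinness there are two
  cases.  Either it is there close to the geodesic from \<open>w\<close> to \<open>p y\<close>, hence near \<open>yH\<close>, or it is close
  to the geodesic from the identity to \<open>p y\<close>; as \<open>p y\<close> is not farther away than \<open>p x\<close>, it is then
  close to \<open>p y\<close>.\<close>

lemma traces_helly:
  assumes R: "0 \<le> R"
  obtains R' where "\<And>Y. finite Y \<Longrightarrow> Y \<subseteq> carrier G \<Longrightarrow> Y \<noteq> {} \<Longrightarrow>
    \<forall>x\<in>Y. \<forall>y\<in>Y. \<exists>h\<in>H. near R x h \<and> near R y h \<Longrightarrow> \<exists>p\<in>H. \<forall>x\<in>Y. near R' x p"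
proof -
  obtain \<delta> where \<delta>: "0 \<le> \<delta>" "\<And>a v b c. Sub.between a v b \<Longrightarrow> c \<in> H \<Longrightarrow>
    (\<exists>s. Sub.between a s c \<and> dH v s \<le> \<delta>) \<or> (\<exists>s. Sub.between b s c \<and> dH v s \<le> \<delta>)"
    using thin_triangles by blast
  obtain Q where Q: "0 \<le> Q" "\<And>x a v b. x \<in> carrier G \<Longrightarrow> near R x a \<Longrightarrow> near R x b \<Longrightarrow>
    Sub.between a v b \<Longrightarrow> near Q x v" using traces_quasiconvex[OF R] by blast
  obtain c where c: "0 \<le> c" "\<And>x p w. x \<in> carrier G \<Longrightarrow> p \<in> H \<Longrightarrow> near R x p \<Longrightarrow> w \<in> H \<Longrightarrow> near R x w \<Longrightarrow>
    (\<And>u. u \<in> H \<Longrightarrow> near R x u \<Longrightarrow> dH \<one> p \<le> dH \<one> u) \<Longrightarrow> \<exists>q. Sub.between \<one> q w \<and> dH p q \<le> c"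
    using projection_on_geodesic[OF R] by blast
  define R' where "R' = R + Q + (K0 * (2 * c + 2 * \<delta>) + \<epsilon>0)"
  have approx: "near R' x p" if "x \<in> carrier G" "p \<in> H" "s \<in> H" "near r x s" "r \<le> R + Q" "dH p s \<le> 2 * c + 2 * \<delta>"
    for x p s r
  proof -
    have "d p s \<le> K0 * (2 * c + 2 * \<delta>) + \<epsilon>0"
      using d_le_dH[OF that(2,3)] mult_left_mono[OF that(6), of K0] const by linarith
    then have "near (r + (K0 * (2 * c + 2 * \<delta>) + \<epsilon>0)) x p"
      by (rule near_trans[OF that(4)]) (use that H_carrier in auto)
    then show ?thesis by (rule near_mono) (use that in \<open>simp add: R'_def\<close>)
  qed
  have "\<exists>p\<in>H. \<forall>x\<in>Y. near R' x p" if Y: "finite Y" "Y \<subseteq> carrier G" "Y \<noteq> {}"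
    and meet': "\<forall>x\<in>Y. \<forall>y\<in>Y. \<exists>h\<in>H. near R x h \<and> near R y h" for Y
  proof -
    have meet: "\<exists>h\<in>H. near R x h \<and> near R y h" if "x \<in> Y" "y \<in> Y" for x y
      using meet' that by blast
    have "\<forall>x\<in>Y. \<exists>p\<in>H. near R x p \<and> (\<forall>u\<in>H. near R x u \<longrightarrow> dH \<one> p \<le> dH \<one> u)"
      using meet closest_point_in_trace by blast
    then obtain p where p: "\<And>x. x \<in> Y \<Longrightarrow> p x \<in> H" "\<And>x. x \<in> Y \<Longrightarrow> near R x (p x)"
      "\<And>x u. x \<in> Y \<Longrightarrow> u \<in> H \<Longrightarrow> near R x u \<Longrightarrow> dH \<one> (p x) \<le> dH \<one> u" by metis
    have "Max ((\<lambda>x. dH \<one> (p x)) ` Y) \<in> (\<lambda>x. dH \<one> (p x)) ` Y" using Y by (intro Max_in) auto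
    then obtain x where "Max ((\<lambda>x. dH \<one> (p x)) ` Y) = dH \<one> (p x)" and x: "x \<in> Y" by (rule imageE)
    then have far: "dH \<one> (p y) \<le> dH \<one> (p x)" if "y \<in> Y" for y
      using Max_ge[of "(\<lambda>x. dH \<one> (p x)) ` Y" "dH \<one> (p y)"] Y(1) that by auto
    have "near R' y (p x)" if y: "y \<in> Y" for y
    proof -
      have xc: "x \<in> carrier G" and yc: "y \<in> carrier G" using Y x y by auto
      obtain w where w: "w \<in> H" "near R x w" "near R y w" using meet[OF x y] by blast
      obtain q where q: "Sub.between \<one> q w" "dH (p x) q \<le> c"
        using c(2)[OF xc p(1,2)[OF x] w(1,2)] p(3)[OF x] by blast
      have qH: "q \<in> H" using between_H[OF q(1)] by blast
      consider s where "Sub.between \<one> s (p y)" "dH q s \<le> \<delta>" | s where "Sub.between w s (p y)" "dH q s \<le> \<delta>"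
        using \<delta>(2)[OF q(1) p(1)[OF y]] by blast
      then show ?thesis
      proof cases
        case 1
        have s: "s \<in> H" using between_H 1 by blast
        have "dH \<one> (p x) \<le> dH \<one> s + dH s (p x)" by (rule dH_triangle[OF H_one s p(1)[OF x]])
        moreover have sx: "dH (p x) s \<le> c + \<delta>" using dH_triangle[OF p(1)[OF x] qH s] q(2) 1(2) by linarith
        moreover have "dH \<one> s + dH s (p y) = dH \<one> (p y)" using between_eq[OF 1(1)] .
        ultimately have "dH s (p y) \<le> c + \<delta>" using far[OF y] dH_sym[OF s p(1)[OF x]] by linarith
        then have "dH (p x) (p y) \<le> 2 * c + 2 * \<delta>"
          using dH_triangle[OF p(1)[OF x] s p(1)[OF y]] sx by linarith
        then show ?thesis using approx[OF yc p(1)[OF x] p(1)[OF y] p(2)[OF y]] Q(1) by simp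
      next
        case 2
        have s: "s \<in> H" using between_H 2 by blast
        have "near Q y s" by (rule Q(2)[OF yc w(3) p(2)[OF y] 2(1)])
        moreover have "dH (p x) s \<le> 2 * c + 2 * \<delta>"
          using dH_triangle[OF p(1)[OF x] qH s] q(2) 2(2) c(1) \<delta>(1) by linarith
        ultimately show ?thesis using approx[OF yc p(1)[OF x] s] R by simp
      qed
    qed
    then show ?thesis using p(1)[OF x] by blast
  qed
  then show thesis using that[of R'] by blast
qed

text \<open>Translate so that one of the cosets is \<open>H\<close> itself.  The traces of the others meet pairwise, so
  all these cosets come near a common point \<open>p\<close>.  They are distinct and each of them meets the ball
  about \<open>p\<close> of a fixed radius, hence their number is at most the size of the ball.\<close>

theorem bounded_packing:
  assumes E: "finite E" "E \<subseteq> carrier G"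
  shows "\<exists>N. \<forall>Y. finite Y \<longrightarrow> Y \<subseteq> carrier G \<longrightarrow>
    (\<forall>x\<in>Y. \<forall>y\<in>Y. x \<noteq> y \<longrightarrow> x <# H \<noteq> y <# H \<and> (\<exists>h\<in>H. \<exists>e\<in>E. \<exists>h'\<in>H. x \<otimes> h \<otimes> e = y \<otimes> h')) \<longrightarrow>
    card Y \<le> N"
proof -
  define D where "D = Max (insert 0 (d \<one> ` E))"
  have D: "0 \<le> D" "e \<in> E \<Longrightarrow> d \<one> e \<le> D" for e unfolding D_def using E(1) by (auto intro!: Max_ge)
  obtain R where R: "D \<le> R" "\<And>x y a b h. x \<in> carrier G \<Longrightarrow> y \<in> carrier G \<Longrightarrow> a \<in> H \<Longrightarrow> near D x a \<Longrightarrow>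
    b \<in> H \<Longrightarrow> near D y b \<Longrightarrow> h \<in> H \<Longrightarrow> near D y (x \<otimes> h) \<Longrightarrow> \<exists>p\<in>H. near R x p \<and> near R y p"
    using close_to_two_cosets[OF D(1)] by blast
  have "0 \<le> R" using R D by simp
  then obtain R' where R': "\<And>Y. finite Y \<Longrightarrow> Y \<subseteq> carrier G \<Longrightarrow> Y \<noteq> {} \<Longrightarrow>
    \<forall>x\<in>Y. \<forall>y\<in>Y. \<exists>h\<in>H. near R x h \<and> near R y h \<Longrightarrow> \<exists>p\<in>H. \<forall>x\<in>Y. near R' x p"
    using traces_helly by blast
  define B where "B = {g \<in> carrier G. d \<one> g \<le> R'}"
  have fB: "finite B" unfolding B_def by (rule finite_ball)
  have "card Y \<le> Suc (card B)" if Y: "finite Y" "Y \<subseteq> carrier G"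
    and close: "\<forall>x\<in>Y. \<forall>y\<in>Y. x \<noteq> y \<longrightarrow> x <# H \<noteq> y <# H \<and> (\<exists>h\<in>H. \<exists>e\<in>E. \<exists>h'\<in>H. x \<otimes> h \<otimes> e = y \<otimes> h')" for Y
  proof (cases "\<exists>x0\<in>Y. Y - {x0} \<noteq> {}")
    case False
    then have "Y = {} \<or> (\<exists>x. Y = {x})" by blast
    then show ?thesis by auto
  next
    case True
    then obtain x0 where x0: "x0 \<in> Y" "Y - {x0} \<noteq> {}" by blast
    then have x0c: "x0 \<in> carrier G" using Y by blast
    have cl: "\<exists>h\<in>H. near D (inv x0 \<otimes> y) (inv x0 \<otimes> x \<otimes> h)" if xy: "x \<in> Y" "y \<in> Y" "x \<noteq> y" for x y
    proof -
      obtain h e h' where h: "h \<in> H" "e \<in> E" "h' \<in> H" "x \<otimes> h \<otimes> e = y \<otimes> h'" using close xy by blast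
      have c: "x \<in> carrier G" "y \<in> carrier G" "h \<in> carrier G" "e \<in> carrier G" "h' \<in> carrier G"
        using Y xy h E H_carrier by auto
      have "d (x \<otimes> h) (y \<otimes> h') = d \<one> e" using word_dist_left_mult[of "x \<otimes> h" \<one> e] c h(4) by simp
      then have "near D y (x \<otimes> h)" unfolding near_def
        by (intro bexI[OF _ h(3)]) (use D(2)[OF h(2)] in simp)
      then have "near D (inv x0 \<otimes> y) (inv x0 \<otimes> (x \<otimes> h))" by (rule near_translate) (use c x0c in auto)
      moreover have "inv x0 \<otimes> (x \<otimes> h) = inv x0 \<otimes> x \<otimes> h" using c x0c by (simp add: m_assoc)
      ultimately show ?thesis using h(1) by metis
    qed
    \<comment> \<open>The translates of the remaining representatives; the coset of \<open>x0\<close> becomes \<open>H\<close>.\<close>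
    let ?Z = "(\<lambda>x. inv x0 \<otimes> x) ` (Y - {x0})"
    have Yc: "inv x0 \<otimes> x \<in> carrier G" if "x \<in> Y" for x using Y x0c that by auto
    have a: "\<exists>a\<in>H. near D (inv x0 \<otimes> x) a" if "x \<in> Y - {x0}" for x
      using cl[of x0 x] that x0 x0c H_carrier by auto
    have "\<exists>p\<in>H. \<forall>x\<in>?Z. near R' x p"
    proof (rule R', goal_cases)
      case 4
      show ?case
      proof (intro ballI)
        fix y y' assume "y \<in> ?Z" "y' \<in> ?Z"
        then obtain x x' where x: "x \<in> Y - {x0}" "y = inv x0 \<otimes> x" and x': "x' \<in> Y - {x0}" "y' = inv x0 \<otimes> x'"
          by blast
        show "\<exists>h\<in>H. near R y h \<and> near R y' h"
        proof (cases "x = x'")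
          case True
          then show ?thesis using a[OF x(1)] x x' near_mono[OF _ R(1)] by blast
        next
          case False
          obtain h where "h \<in> H" "near D y' (y \<otimes> h)" using cl[of x x'] False x x' by blast
          moreover obtain a1 a2 where "a1 \<in> H" "near D y a1" "a2 \<in> H" "near D y' a2"
            using a x x' by blast
          ultimately show ?thesis using R(2)[of y y' a1 a2 h] Yc x x' by blast
        qed
      qed
    qed (use Y x0 Yc in auto)
    then obtain p where p: "p \<in> H" "\<And>x. x \<in> Y - {x0} \<Longrightarrow> near R' (inv x0 \<otimes> x) p" by blast
    then obtain k where k: "\<And>x. x \<in> Y - {x0} \<Longrightarrow> k x \<in> H"
      "\<And>x. x \<in> Y - {x0} \<Longrightarrow> d p (inv x0 \<otimes> x \<otimes> k x) \<le> R'" unfolding near_def by metis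
    define b where "b x = inv p \<otimes> (inv x0 \<otimes> x \<otimes> k x)" for x
    have kc: "k x \<in> carrier G" "x \<in> carrier G" if "x \<in> Y - {x0}" for x using k(1)[OF that] H_carrier Y that by auto
    have pc: "p \<in> carrier G" using p H_carrier by blast
    have "inj_on b (Y - {x0})"
    proof (rule inj_onI)
      fix x y assume xy: "x \<in> Y - {x0}" "y \<in> Y - {x0}" "b x = b y"
      then have "inv x0 \<otimes> x \<otimes> k x = inv x0 \<otimes> y \<otimes> k y"
        unfolding b_def using kc[OF xy(1)] kc[OF xy(2)] pc x0c by simp
      then have e: "x \<otimes> k x = y \<otimes> k y" using kc[OF xy(1)] kc[OF xy(2)] x0c by (simp add: m_assoc)
      have "z <# H = (z \<otimes> k z) <# H" if "z \<in> Y - {x0}" for z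
        by (rule l_repr_independence[OF _ kc(2)[OF that] sub]) (use k(1)[OF that] in \<open>auto simp: l_coset_def\<close>)
      then have "x <# H = y <# H" using xy e by simp
      then show "x = y" using close xy by blast
    qed
    moreover have "b ` (Y - {x0}) \<subseteq> B"
    proof
      fix g assume "g \<in> b ` (Y - {x0})"
      then obtain x where x: "x \<in> Y - {x0}" "g = b x" by blast
      have bc: "b x \<in> carrier G" unfolding b_def using kc[OF x(1)] pc x0c by simp
      have "p \<otimes> b x = inv x0 \<otimes> x \<otimes> k x" unfolding b_def
        using kc[OF x(1)] pc x0c by (simp add: m_assoc[symmetric])
      then have "d \<one> (b x) \<le> R'" using word_dist_left_mult[of p \<one> "b x"] k(2)[OF x(1)] pc bc by simp
      then show "g \<in> B" unfolding B_def using bc x by simp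
    qed
    ultimately have "card (Y - {x0}) \<le> card B" using fB card_inj_on_le by blast
    then show ?thesis using x0(1) Y(1) by (simp add: card_Diff_singleton)
  qed
  then show ?thesis by blast
qed

end

section \<open>Crossing halfspaces\<close>

locale codimension_one = group G for G (structure) +
  fixes H A
  assumes sub: "subgroup H G" and witness: "codimension_one_witness G H A"
begin

lemma A_carrier: "A \<subseteq> carrier G"
  using witness by (simp add: codimension_one_witness_def)

lemma H_carrier: "h \<in> H \<Longrightarrow> h \<in> carrier G"
  using sub by (rule subgroup.mem_carrier)

lemma mem_translate_iff:
  assumes "g \<in> carrier G" "y \<in> carrier G"
  shows "y \<in> g <# A \<longleftrightarrow> inv g \<otimes> y \<in> A"
proof
  assume "y \<in> g <# A"
  then obtain a where a: "a \<in> A" "y = g \<otimes> a" unfolding l_coset_def by blast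
  then have "inv g \<otimes> y = a" using assms A_carrier by (auto simp: m_assoc[symmetric])
  then show "inv g \<otimes> y \<in> A" using a by simp
next
  assume a: "inv g \<otimes> y \<in> A"
  have "y = g \<otimes> (inv g \<otimes> y)" using assms by (simp add: m_assoc[symmetric])
  then show "y \<in> g <# A" unfolding l_coset_def using a by blast
qed

lemma finite_quotient_representatives:
  assumes "finite (left_quotient G H B)" "B \<subseteq> carrier G"
  shows "\<exists>E\<subseteq>B. finite E \<and> (\<forall>x\<in>B. \<exists>h\<in>H. \<exists>e\<in>E. x = h \<otimes> e)"
proof -
  obtain E where E: "E \<subseteq> B" "finite E" "(\<lambda>x. H #> x) ` B = (\<lambda>x. H #> x) ` E"
    using finite_subset_image[OF assms(1), of "\<lambda>x. H #> x" B] unfolding left_quotient_def by auto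
  have "\<exists>h\<in>H. \<exists>e\<in>E. x = h \<otimes> e" if x: "x \<in> B" for x
  proof -
    have "H #> x \<in> (\<lambda>x. H #> x) ` E" using x E(3) by blast
    then obtain e where e: "e \<in> E" "H #> x = H #> e" by blast
    have "x \<in> H #> x" using rcos_self[OF _ sub] x assms(2) by blast
    then show ?thesis using e unfolding r_coset_def by blast
  qed
  then show ?thesis using E by blast
qed

text \<open>Right multiplication by \<open>q\<close> moves a point into or out of \<open>A\<close> only if the point lies in the
  symmetric difference of \<open>A\<close> and the right translate of \<open>A\<close> by the inverse of \<open>q\<close>, which is finite
  modulo \<open>H\<close>.\<close>

lemma almost_invariant:
  assumes Q: "finite Q" "Q \<subseteq> carrier G"
  shows "\<exists>E. finite E \<and> E \<subseteq> carrier G \<and> (\<forall>q\<in>Q. \<forall>y\<in>carrier G.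
    (y \<in> A) \<noteq> (y \<otimes> q \<in> A) \<longrightarrow> (\<exists>h\<in>H. \<exists>e\<in>E. y = h \<otimes> e))"
proof -
  have shift: "y \<in> A #> inv q \<longleftrightarrow> y \<otimes> q \<in> A" if "y \<in> carrier G" "q \<in> carrier G" for y q
  proof
    assume "y \<in> A #> inv q"
    then obtain a where a: "a \<in> A" "y = a \<otimes> inv q" unfolding r_coset_def by blast
    then have "y \<otimes> q = a" using that A_carrier by (auto simp: m_assoc)
    then show "y \<otimes> q \<in> A" using a by simp
  next
    assume a: "y \<otimes> q \<in> A"
    have "y = y \<otimes> q \<otimes> inv q" using that by (simp add: m_assoc)
    then show "y \<in> A #> inv q" unfolding r_coset_def using a by blast
  qed
  have "\<exists>E\<subseteq>carrier G. finite E \<and> (\<forall>y\<in>carrier G. (y \<in> A) \<noteq> (y \<otimes> q \<in> A) \<longrightarrow> (\<exists>h\<in>H. \<exists>e\<in>E. y = h \<otimes> e))"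
    if q: "q \<in> Q" for q
  proof -
    have qc: "q \<in> carrier G" using q Q by blast
    let ?B = "sym_diff A (A #> inv q)"
    have "finite (left_quotient G H ?B)"
      using witness qc unfolding codimension_one_witness_def by simp
    moreover have Bc: "?B \<subseteq> carrier G" using A_carrier qc r_coset_subset_G[OF A_carrier, of "inv q"] by auto
    ultimately obtain E where E: "E \<subseteq> ?B" "finite E" "\<And>x. x \<in> ?B \<Longrightarrow> \<exists>h\<in>H. \<exists>e\<in>E. x = h \<otimes> e"
      using finite_quotient_representatives by metis
    have "\<exists>h\<in>H. \<exists>e\<in>E. y = h \<otimes> e" if "y \<in> carrier G" "(y \<in> A) \<noteq> (y \<otimes> q \<in> A)" for y
      by (rule E(3)) (use that shift[OF that(1) qc] in auto)
    then show ?thesis using E(1,2) Bc by (intro exI[of _ E]) blast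
  qed
  then obtain f where f: "\<And>q. q \<in> Q \<Longrightarrow> f q \<subseteq> carrier G" "\<And>q. q \<in> Q \<Longrightarrow> finite (f q)"
    "\<And>q y. q \<in> Q \<Longrightarrow> y \<in> carrier G \<Longrightarrow> (y \<in> A) \<noteq> (y \<otimes> q \<in> A) \<Longrightarrow> \<exists>h\<in>H. \<exists>e\<in>f q. y = h \<otimes> e"
    by metis
  show ?thesis
  proof (intro exI[of _ "\<Union>q\<in>Q. f q"] conjI ballI impI)
    fix q y assume "q \<in> Q" "y \<in> carrier G" "(y \<in> A) \<noteq> (y \<otimes> q \<in> A)"
    from f(3)[OF this] show "\<exists>h\<in>H. \<exists>e\<in>\<Union>q\<in>Q. f q. y = h \<otimes> e" using \<open>q \<in> Q\<close> by blast
  qed (use f Q in auto)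
qed

lemma translate_almost_invariant:
  assumes E: "\<forall>q\<in>Q. \<forall>y\<in>carrier G. (y \<in> A) \<noteq> (y \<otimes> q \<in> A) \<longrightarrow> (\<exists>h\<in>H. \<exists>e\<in>E. y = h \<otimes> e)"
    and c: "Q \<subseteq> carrier G" "E \<subseteq> carrier G" "g \<in> carrier G" "y \<in> carrier G"
    and q: "q \<in> Q" "(y \<in> g <# A) \<noteq> (y \<otimes> q \<in> g <# A)"
  shows "\<exists>h\<in>H. \<exists>e\<in>E. y = g \<otimes> h \<otimes> e"
proof -
  have qc: "q \<in> carrier G" using c q by blast
  have "(inv g \<otimes> y \<in> A) \<noteq> (inv g \<otimes> y \<otimes> q \<in> A)"
    using q(2) mem_translate_iff[of g] c qc by (simp add: m_assoc)
  then obtain h e where h: "h \<in> H" "e \<in> E" "inv g \<otimes> y = h \<otimes> e" using E q(1) c by (meson inv_closed m_closed)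
  have ec: "e \<in> carrier G" using h c by blast
  have "y = g \<otimes> (inv g \<otimes> y)" using c by (simp add: m_assoc[symmetric])
  also have "\<dots> = g \<otimes> h \<otimes> e" unfolding h(3) using c ec H_carrier[OF h(1)] by (simp add: m_assoc)
  finally show ?thesis using h by blast
qed

lemma closed_under_generators:
  assumes S: "S \<subseteq> carrier G" "generate G S = carrier G"
    and y: "P y" "y \<in> carrier G"
    and step: "\<And>y s. y \<in> carrier G \<Longrightarrow> P y \<Longrightarrow> s \<in> S \<union> (\<lambda>s. inv s) ` S \<Longrightarrow> P (y \<otimes> s)"
    and z: "z \<in> carrier G"
  shows "P z"
proof -
  have "\<forall>y\<in>carrier G. P y \<longrightarrow> P (y \<otimes> w)" if "w \<in> generate G S" for w
    using that
  proof induction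
    case (eng h1 h2)
    have "h1 \<in> carrier G" "h2 \<in> carrier G" using eng S generate_incl by auto
    then show ?case using eng by (auto simp: m_assoc[symmetric])
  qed (use step in auto)
  moreover have "inv y \<otimes> z \<in> generate G S" using S y z by simp
  ultimately have "P (y \<otimes> (inv y \<otimes> z))" using y by blast
  then show ?thesis using y z by (simp add: m_assoc[symmetric])
qed

text \<open>The four intersections of \<open>B\<close> or its complement with \<open>C\<close> or its complement are indexed by
  truth values, so that passing to a complement negates an index.\<close>

definition corner :: "bool \<Rightarrow> bool \<Rightarrow> 'a set \<Rightarrow> 'a set \<Rightarrow> 'a set" where
  "corner a b B C = {y \<in> carrier G. (y \<in> B \<longleftrightarrow> a) \<and> (y \<in> C \<longleftrightarrow> b)}"

text \<open>Write \<open>B\<close> for \<open>gA\<close> and \<open>C\<close> for \<open>xA\<close>.  The boundary of \<open>B\<close> lies in \<open>g H E1\<close> for a finite set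
  \<open>E1\<close>, and this set can be run through, from \<open>g\<close>, by steps in \<open>T\<close> or their
  inverses and a last step in \<open>E1\<close>.  If \<open>gH\<close>
  is far from \<open>xH\<close>, then no such step crosses the boundary of \<open>C\<close>, so \<open>g H E1\<close> lies on one side of
  \<open>C\<close>; similarly with the roles exchanged.  The corner formed by the two sides that are avoided meets
  neither boundary, is therefore closed under right multiplication by generators, and so is empty or
  all of \<open>G\<close>.  In both cases some corner is empty.\<close>

lemma crossing_cosets_close:
  assumes S: "finite_generating_set G S" and T: "finite_generating_set (G\<lparr>carrier := H\<rparr>) T"
  shows "\<exists>E. finite E \<and> E \<subseteq> carrier G \<and> (\<forall>g\<in>carrier G. \<forall>x\<in>carrier G.
    (\<forall>a b. corner a b (g <# A) (x <# A) \<noteq> {}) \<longrightarrow> (\<exists>h\<in>H. \<exists>e\<in>E. \<exists>h'\<in>H. g \<otimes> h \<otimes> e = x \<otimes> h'))"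
proof -
  have S': "finite S" "S \<subseteq> carrier G" "generate G S = carrier G" using S by (auto simp: finite_generating_set_def)
  have T': "finite T" "T \<subseteq> H" "generate (G\<lparr>carrier := H\<rparr>) T = H" using T by (auto simp: finite_generating_set_def)
  let ?S = "S \<union> (\<lambda>s. inv s) ` S"
  have Sc: "?S \<subseteq> carrier G" "finite ?S" using S'(1,2) by auto
  obtain E1 where E1: "finite E1" "E1 \<subseteq> carrier G"
    "\<forall>q\<in>?S. \<forall>y\<in>carrier G. (y \<in> A) \<noteq> (y \<otimes> q \<in> A) \<longrightarrow> (\<exists>h\<in>H. \<exists>e\<in>E1. y = h \<otimes> e)"
    using almost_invariant[OF Sc(2,1)] by blast
  let ?Q = "T \<union> (\<lambda>s. inv s) ` T \<union> E1"
  have TG: "T \<subseteq> carrier G" using T'(2) H_carrier by blast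
  then have Qc: "?Q \<subseteq> carrier G" using E1(2) by auto
  obtain E2 where E2: "finite E2" "E2 \<subseteq> carrier G"
    "\<forall>q\<in>?Q. \<forall>y\<in>carrier G. (y \<in> A) \<noteq> (y \<otimes> q \<in> A) \<longrightarrow> (\<exists>h\<in>H. \<exists>e\<in>E2. y = h \<otimes> e)"
    using almost_invariant[OF _ Qc] T'(1) E1(1) by auto
  \<comment> \<open>The inverses let the conclusion be read in both directions, from \<open>gH\<close> to \<open>xH\<close> and back.\<close>
  let ?E = "E2 \<union> (\<lambda>e. inv e) ` E2"
  define far where "far g x \<longleftrightarrow> (\<forall>h\<in>H. \<forall>h'\<in>H. \<forall>e\<in>E2. g \<otimes> h \<noteq> x \<otimes> h' \<otimes> e)" for g x
  have one_side: "\<exists>c. \<forall>h\<in>H. \<forall>e\<in>E1. (g \<otimes> h \<otimes> e \<in> x <# A) = c"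
    if gx: "g \<in> carrier G" "x \<in> carrier G" and far: "far g x" for g x
  proof -
    have inv_step: "(g \<otimes> h \<in> x <# A) = (g \<otimes> h \<otimes> q \<in> x <# A)" if h: "h \<in> H" and q: "q \<in> ?Q" for h q
    proof (rule ccontr)
      assume "(g \<otimes> h \<in> x <# A) \<noteq> (g \<otimes> h \<otimes> q \<in> x <# A)"
      then obtain h' e where "h' \<in> H" "e \<in> E2" "g \<otimes> h = x \<otimes> h' \<otimes> e"
        using translate_almost_invariant[OF E2(3) Qc E2(2) gx(2) _ q, of "g \<otimes> h"] gx H_carrier[OF h] by auto
      then show False using far h unfolding far_def by blast
    qed
    have HG: "group (G\<lparr>carrier := H\<rparr>)" using subgroup.subgroup_is_group[OF sub is_group] .
    have run: "\<forall>h0\<in>H. (g \<otimes> (h0 \<otimes> h) \<in> x <# A) = (g \<otimes> h0 \<in> x <# A)"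
      if "h \<in> generate (G\<lparr>carrier := H\<rparr>) T" for h
      using that
    proof induction
      case one
      then show ?case using H_carrier by simp
    next
      case (incl t)
      then show ?case using inv_step[of _ t] gx H_carrier TG by (auto simp: m_assoc subset_iff)
    next
      case (inv t)
      have t: "inv\<^bsub>G\<lparr>carrier := H\<rparr>\<^esub> t = inv t" "t \<in> carrier G"
        using m_inv_consistent[OF sub] inv T' TG by auto
      then show ?case using inv_step[of _ "inv t"] inv gx H_carrier by (auto simp: m_assoc)
    next
      case (eng h1 h2)
      have "h1 \<in> H" "h2 \<in> H" using eng T'(3) by auto
      then show ?case using eng H_carrier subgroup.m_closed[OF sub] by (simp add: m_assoc[symmetric])
    qed
    have "(g \<otimes> h \<otimes> e \<in> x <# A) = (g \<in> x <# A)" if "h \<in> H" "e \<in> E1" for h e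
      using inv_step[of h e] run[of h] that T'(3) subgroup.one_closed[OF sub] gx H_carrier by auto
    then show ?thesis by blast
  qed
  have some_corner_empty: "\<exists>a b. corner a b (g <# A) (x <# A) = {}"
    if gx: "g \<in> carrier G" "x \<in> carrier G" and far: "far g x" "far x g" for g x
  proof (rule ccontr)
    assume "\<not> ?thesis"
    then have ne: "corner a b (g <# A) (x <# A) \<noteq> {}" for a b by blast
    obtain c1 where c1: "\<And>h e. h \<in> H \<Longrightarrow> e \<in> E1 \<Longrightarrow> (g \<otimes> h \<otimes> e \<in> x <# A) = c1"
      using one_side[OF gx far(1)] by blast
    obtain c2 where c2: "\<And>h e. h \<in> H \<Longrightarrow> e \<in> E1 \<Longrightarrow> (x \<otimes> h \<otimes> e \<in> g <# A) = c2"
      using one_side[OF gx(2,1) far(2)] by blast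
    let ?C = "corner (\<not> c2) (\<not> c1) (g <# A) (x <# A)"
    have step: "y \<otimes> s \<in> ?C" if y: "y \<in> carrier G" "y \<in> ?C" and s: "s \<in> ?S" for y s
    proof -
      have sc: "s \<in> carrier G" using Sc(1) s by blast
      have "(y \<in> g <# A) = (y \<otimes> s \<in> g <# A)"
      proof (rule ccontr)
        assume "(y \<in> g <# A) \<noteq> (y \<otimes> s \<in> g <# A)"
        then obtain h e where "h \<in> H" "e \<in> E1" "y = g \<otimes> h \<otimes> e"
          using translate_almost_invariant[OF E1(3) Sc(1) E1(2) gx(1) y(1) s] by blast
        then show False using c1 y(2) unfolding corner_def by auto
      qed
      moreover have "(y \<in> x <# A) = (y \<otimes> s \<in> x <# A)"
      proof (rule ccontr)
        assume "(y \<in> x <# A) \<noteq> (y \<otimes> s \<in> x <# A)"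
        then obtain h e where "h \<in> H" "e \<in> E1" "y = x \<otimes> h \<otimes> e"
          using translate_almost_invariant[OF E1(3) Sc(1) E1(2) gx(2) y(1) s] by blast
        then show False using c2 y(2) unfolding corner_def by auto
      qed
      ultimately show ?thesis using y sc unfolding corner_def by simp
    qed
    obtain y where y: "y \<in> ?C" using ne by blast
    then have "y \<in> carrier G" unfolding corner_def by simp
    then have all: "z \<in> ?C" if "z \<in> carrier G" for z
      using closed_under_generators[OF S'(2,3), of "\<lambda>y. y \<in> ?C" y z] y step that by blast
    obtain z where z: "z \<in> corner c2 c1 (g <# A) (x <# A)" using ne by blast
    then have "z \<in> carrier G" unfolding corner_def by simp
    from all[OF this] z show False unfolding corner_def by simp
  qed
  show ?thesis
  proof (intro exI[of _ ?E] conjI ballI impI)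
    show "finite ?E" "?E \<subseteq> carrier G" using E2 by auto
    fix g x assume gx: "g \<in> carrier G" "x \<in> carrier G" and cr: "\<forall>a b. corner a b (g <# A) (x <# A) \<noteq> {}"
    have "\<not> (far g x \<and> far x g)" using some_corner_empty[OF gx] cr by blast
    then consider h h' e where "h \<in> H" "h' \<in> H" "e \<in> E2" "g \<otimes> h = x \<otimes> h' \<otimes> e"
      | h h' e where "h \<in> H" "h' \<in> H" "e \<in> E2" "x \<otimes> h = g \<otimes> h' \<otimes> e" unfolding far_def by blast
    then show "\<exists>h\<in>H. \<exists>e\<in>?E. \<exists>h'\<in>H. g \<otimes> h \<otimes> e = x \<otimes> h'"
    proof cases
      case 1
      have ec: "e \<in> carrier G" using 1 E2 by blast
      have "g \<otimes> h \<otimes> inv e = x \<otimes> h'" unfolding 1(4) using gx ec H_carrier[OF 1(2)] by (simp add: m_assoc)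
      then show ?thesis using 1 by blast
    next
      case 2
      then show ?thesis by (metis UnI1)
    qed
  qed
qed

section \<open>Cubes and crossing halfspaces\<close>

abbreviation compl where "compl B \<equiv> carrier G - B"

lemma halfspace_carrier: "B \<in> halfspaces G A \<Longrightarrow> B \<subseteq> carrier G"
  unfolding halfspaces_def using l_coset_subset_G[OF A_carrier] by auto

lemma compl_compl: "B \<in> halfspaces G A \<Longrightarrow> compl (compl B) = B"
  using halfspace_carrier by blast

lemma compl_halfspace: "B \<in> halfspaces G A \<Longrightarrow> compl B \<in> halfspaces G A"
  using compl_compl unfolding halfspaces_def by auto

lemma vertexD:
  assumes "V \<in> sageev_vertices G A"
  shows "B \<in> V \<Longrightarrow> B \<in> halfspaces G A" "B \<in> halfspaces G A \<Longrightarrow> (B \<in> V) \<noteq> (compl B \<in> V)"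
    "B \<in> V \<Longrightarrow> C \<in> halfspaces G A \<Longrightarrow> B \<subseteq> C \<Longrightarrow> C \<in> V"
  using assms unfolding sageev_vertices_def by blast+

lemma vertex_members_meet:
  assumes V: "V \<in> sageev_vertices G A" and B: "B \<in> V" "C \<in> V"
  shows "\<exists>y\<in>carrier G. y \<in> B \<and> y \<in> C"
proof (rule ccontr)
  assume "\<not> ?thesis"
  then have "B \<subseteq> compl C" using halfspace_carrier[OF vertexD(1)[OF V B(1)]] by blast
  moreover have C: "C \<in> halfspaces G A" using vertexD(1)[OF V B(2)] .
  ultimately have "compl C \<in> V" using vertexD(3)[OF V B(1) compl_halfspace] by blast
  then show False using vertexD(2)[OF V C] B(2) by blast
qed

text \<open>Edges are unordered pairs, but flipping back replaces the complement of \<open>B\<close> by \<open>B\<close>, so an edge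
  may be read as a flip from either end.\<close>

lemma edge_flip:
  assumes "{V, W} \<in> sageev_edges G A"
  shows "V \<in> sageev_vertices G A \<and> (\<exists>B\<in>V. W = insert (compl B) (V - {B}))"
proof -
  obtain V1 V2 B where e: "{V, W} = {V1, V2}" "V1 \<in> sageev_vertices G A" "V2 \<in> sageev_vertices G A"
    "B \<in> V1" "V2 = insert (compl B) (V1 - {B})"
    using assms unfolding sageev_edges_def by blast
  have B: "B \<in> halfspaces G A" by (rule vertexD(1)[OF e(2,4)])
  have nB: "compl B \<notin> V1" using vertexD(2)[OF e(2) B] e(4) by blast
  consider "V = V1" "W = V2" | "V = V2" "W = V1" using e(1) by (auto simp: doubleton_eq_iff)
  then show ?thesis
  proof cases
    case 1
    then show ?thesis using e by blast
  next
    case 2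
    have "V1 = insert (compl (compl B)) (V2 - {compl B})"
      unfolding compl_compl[OF B] using e(4,5) nB by auto
    moreover have "compl B \<in> V2" using e(5) by blast
    ultimately show ?thesis using 2 e(3) by blast
  qed
qed

text \<open>The halfspaces flipped along the edges at the vertex \<open>\<phi> {}\<close> cross pairwise.  In the square
  spanned by two of these edges, the fourth vertex differs from \<open>\<phi> {}\<close>, so neither flip is undone
  there, and the four vertices of the square contain the four pairs of halfspaces that define the
  corners.  Two halfspaces in a common vertex intersect, because the vertex is closed under supersets
  and does not contain complements of its members.\<close>

lemma cube_crossing_halfspaces:
  assumes "sageev_cubes G A n \<noteq> {}"
  shows "\<exists>B. (\<forall>i<n. B i \<in> halfspaces G A) \<and> (\<forall>i<n. \<forall>j<n. i \<noteq> j \<longrightarrow>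
    B i \<noteq> B j \<and> B i \<noteq> compl (B j) \<and> (\<forall>a b. corner a b (B i) (B j) \<noteq> {}))"
proof -
  obtain W F \<phi> where WF: "W \<subseteq> sageev_vertices G A" "F \<subseteq> sageev_edges G A"
    "bij_betw \<phi> (Pow {..<n}) W"
    "F = {{\<phi> J, \<phi> (insert i J)} | i J. J \<subseteq> {..<n} \<and> i < n \<and> i \<notin> J}"
    using assms unfolding sageev_cubes_def by auto
  have inj: "\<phi> J = \<phi> K \<longleftrightarrow> J = K" if "J \<subseteq> {..<n}" "K \<subseteq> {..<n}" for J K
    using WF(3) that unfolding bij_betw_def inj_on_def by blast
  have edge: "{\<phi> J, \<phi> (insert i J)} \<in> sageev_edges G A" if "J \<subseteq> {..<n}" "i < n" "i \<notin> J" for i J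
    using WF(2,4) that by blast
  have vert: "\<phi> J \<in> sageev_vertices G A" if "J \<subseteq> {..<n}" for J
    using WF(1,3) that unfolding bij_betw_def by blast
  define V where "V = \<phi> {}"
  have V: "V \<in> sageev_vertices G A" unfolding V_def by (rule vert) simp
  have "\<forall>i<n. \<exists>B\<in>V. \<phi> {i} = insert (compl B) (V - {B})"
    using edge_flip[OF edge[of "{}"]] unfolding V_def by auto
  then obtain B where B: "\<And>i. i < n \<Longrightarrow> B i \<in> V" "\<And>i. i < n \<Longrightarrow> \<phi> {i} = insert (compl (B i)) (V - {B i})"
    by metis
  have BH: "B i \<in> halfspaces G A" if "i < n" for i by (rule vertexD(1)[OF V B(1)[OF that]])
  have nB: "compl (B i) \<notin> V" if "i < n" for i using vertexD(2)[OF V BH[OF that]] B(1)[OF that] by blast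
  have opposite: "compl (B i) \<in> \<phi> {i, j}" if ij: "i < n" "j < n" "i \<noteq> j" for i j
  proof (rule ccontr)
    assume n: "compl (B i) \<notin> \<phi> {i, j}"
    have "{\<phi> {i}, \<phi> (insert j {i})} \<in> sageev_edges G A" by (rule edge) (use ij in auto)
    then obtain C where C: "C \<in> \<phi> {i}" "\<phi> {i, j} = insert (compl C) (\<phi> {i} - {C})"
      using edge_flip by (metis insert_commute)
    have "compl (B i) \<in> \<phi> {i}" using B(2)[OF ij(1)] by blast
    then have "C = compl (B i)" using n C(2) by blast
    \<comment> \<open>The second flip would undo the first and lead back to \<open>\<phi> {}\<close>.\<close>
    then have "\<phi> {i, j} = insert (B i) (\<phi> {i} - {compl (B i)})" using C(2) compl_compl[OF BH[OF ij(1)]] by simp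
    also have "\<dots> = V" unfolding B(2)[OF ij(1)] using B(1)[OF ij(1)] nB[OF ij(1)] by blast
    finally have "{i, j} = {}" unfolding V_def using inj[of "{i, j}" "{}"] ij by simp
    then show False by simp
  qed
  have "B i \<noteq> B j \<and> B i \<noteq> compl (B j) \<and> (\<forall>a b. corner a b (B i) (B j) \<noteq> {})"
    if ij: "i < n" "j < n" "i \<noteq> j" for i j
  proof (intro conjI allI)
    show ne: "B i \<noteq> B j"
    proof
      assume "B i = B j"
      then have "\<phi> {i} = \<phi> {j}" using B(2) ij by simp
      then show False using inj[of "{i}" "{j}"] ij by simp
    qed
    show "B i \<noteq> compl (B j)" using nB[OF ij(2)] B(1)[OF ij(1)] by metis
    have Vi: "\<phi> {i} \<in> sageev_vertices G A" "\<phi> {j} \<in> sageev_vertices G A" "\<phi> {i, j} \<in> sageev_vertices G A"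
      using vert ij by auto
    have "\<exists>y\<in>carrier G. y \<in> B i \<and> y \<in> B j" by (rule vertex_members_meet[OF V B(1)[OF ij(1)] B(1)[OF ij(2)]])
    moreover have "\<exists>y\<in>carrier G. y \<in> compl (B i) \<and> y \<in> B j"
      by (rule vertex_members_meet[OF Vi(1)]) (use B ij ne in auto)
    moreover have "\<exists>y\<in>carrier G. y \<in> B i \<and> y \<in> compl (B j)"
      by (rule vertex_members_meet[OF Vi(2)]) (use B ij ne in auto)
    moreover have "\<exists>y\<in>carrier G. y \<in> compl (B i) \<and> y \<in> compl (B j)"
      by (rule vertex_members_meet[OF Vi(3)]) (use opposite[OF ij] opposite[of j i] ij in \<open>auto simp: insert_commute\<close>)
    ultimately show "corner a b (B i) (B j) \<noteq> {}" for a b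
      unfolding corner_def by (cases a; cases b) auto
  qed
  then show ?thesis using BH by blast
qed

text \<open>A halfspace and its complement have the same crossings, so each halfspace of the preceding lemma
  may be replaced by the translate of \<open>A\<close> that defines it.\<close>

lemma cube_crossing_translates:
  assumes "sageev_cubes G A n \<noteq> {}"
  shows "\<exists>Y. Y \<subseteq> carrier G \<and> finite Y \<and> card Y = n \<and> (\<forall>x\<in>Y. \<forall>y\<in>Y. x \<noteq> y \<longrightarrow>
    x <# A \<noteq> y <# A \<and> (\<forall>a b. corner a b (x <# A) (y <# A) \<noteq> {}))"
proof -
  obtain B where B: "\<And>i. i < n \<Longrightarrow> B i \<in> halfspaces G A" and cross: "\<And>i j. i < n \<Longrightarrow> j < n \<Longrightarrow> i \<noteq> j \<Longrightarrow>
    B i \<noteq> B j \<and> B i \<noteq> compl (B j) \<and> (\<forall>a b. corner a b (B i) (B j) \<noteq> {})"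
    using cube_crossing_halfspaces[OF assms] by blast
  have "\<exists>x\<in>carrier G. B i = x <# A \<or> B i = compl (x <# A)" if "i < n" for i
    using B[OF that] unfolding halfspaces_def by blast
  then obtain x where x: "\<And>i. i < n \<Longrightarrow> x i \<in> carrier G"
    "\<And>i. i < n \<Longrightarrow> B i = x i <# A \<or> B i = compl (x i <# A)" by metis
  have xc: "x i <# A \<subseteq> carrier G" if "i < n" for i using l_coset_subset_G[OF A_carrier x(1)[OF that]] .
  have cr: "x i <# A \<noteq> x j <# A \<and> (\<forall>a b. corner a b (x i <# A) (x j <# A) \<noteq> {})"
    if ij: "i < n" "j < n" "i \<noteq> j" for i j
  proof (intro conjI allI)
    have "compl (compl (x j <# A)) = x j <# A" using xc[OF ij(2)] by blast
    then show "x i <# A \<noteq> x j <# A" using cross[OF ij] x(2)[OF ij(1)] x(2)[OF ij(2)] by metis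
    fix a b
    define a' where "a' = (if B i = x i <# A then a else \<not> a)"
    define b' where "b' = (if B j = x j <# A then b else \<not> b)"
    have "corner a' b' (B i) (B j) = corner a b (x i <# A) (x j <# A)"
      unfolding corner_def a'_def b'_def using x(2)[OF ij(1)] x(2)[OF ij(2)] by auto
    then show "corner a b (x i <# A) (x j <# A) \<noteq> {}" using cross[OF ij] by metis
  qed
  have inj: "inj_on x {..<n}" using cr by (intro inj_onI) (metis lessThan_iff)
  then have "card (x ` {..<n}) = n" by (simp add: card_image)
  moreover have "u <# A \<noteq> v <# A \<and> (\<forall>a b. corner a b (u <# A) (v <# A) \<noteq> {})"
    if "u \<in> x ` {..<n}" "v \<in> x ` {..<n}" "u \<noteq> v" for u v
    using that cr by blast
  ultimately show ?thesis using x(1) by (intro exI[of _ "x ` {..<n}"]) blast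
qed

lemma translate_eq_if_coset_eq:
  assumes "x \<in> carrier G" "y \<in> carrier G" "x <# H = y <# H" shows "x <# A = y <# A"
proof -
  have "H <#> A = A" using witness by (simp add: codimension_one_witness_def)
  then show ?thesis
    using setmult_lcos_assoc[OF subgroup.subset[OF sub] A_carrier assms(1)]
      setmult_lcos_assoc[OF subgroup.subset[OF sub] A_carrier assms(2)] assms(3) by simp
qed

end

section \<open>Finite dimension\<close>

theorem corollary1p3:
  fixes G :: "('a, 'b) monoid_scheme" and H A :: "'a set"
  assumes "group G" and "finitely_generated G"
    and "subgroup H G" and "finitely_generated (G\<lparr>carrier := H\<rparr>)"
    and "stable_subgroup G H"
    and "codimension_one_subgroup G H"
    and "codimension_one_witness G H A"
  shows "sageev_complex_finite_dimensional G A"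
proof -
  interpret group G by fact
  obtain S T K0 \<epsilon>0 where "stable_pair G S H T K0 \<epsilon>0"
    using stable_subgroup_stable_pair assms(1,5) by blast
  then interpret stable_pair G S H T K0 \<epsilon>0 .
  interpret C: codimension_one G H A by (intro codimension_one.intro codimension_one_axioms.intro assms)
  from C.crossing_cosets_close[OF generators Sub.generators] obtain E where
    E: "finite E" "E \<subseteq> carrier G" and close: "\<forall>g\<in>carrier G. \<forall>x\<in>carrier G.
      (\<forall>a b. C.corner a b (g <#\<^bsub>G\<^esub> A) (x <#\<^bsub>G\<^esub> A) \<noteq> {}) \<longrightarrow>
      (\<exists>h\<in>H. \<exists>e\<in>E. \<exists>h'\<in>H. g \<otimes>\<^bsub>G\<^esub> h \<otimes>\<^bsub>G\<^esub> e = x \<otimes>\<^bsub>G\<^esub> h')"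
    by (elim exE conjE)
  from bounded_packing[OF E] obtain N where N: "\<forall>Y. finite Y \<longrightarrow> Y \<subseteq> carrier G \<longrightarrow>
    (\<forall>x\<in>Y. \<forall>y\<in>Y. x \<noteq> y \<longrightarrow> x <#\<^bsub>G\<^esub> H \<noteq> y <#\<^bsub>G\<^esub> H \<and>
      (\<exists>h\<in>H. \<exists>e\<in>E. \<exists>h'\<in>H. x \<otimes>\<^bsub>G\<^esub> h \<otimes>\<^bsub>G\<^esub> e = y \<otimes>\<^bsub>G\<^esub> h')) \<longrightarrow> card Y \<le> N" ..
  have "n \<le> N" if cube: "sageev_cubes G A n \<noteq> {}" for n
  proof -
    obtain Y where Y: "Y \<subseteq> carrier G" "finite Y" "card Y = n" and cross: "\<And>x y. x \<in> Y \<Longrightarrow> y \<in> Y \<Longrightarrow> x \<noteq> y \<Longrightarrow>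
      x <#\<^bsub>G\<^esub> A \<noteq> y <#\<^bsub>G\<^esub> A \<and> (\<forall>a b. C.corner a b (x <#\<^bsub>G\<^esub> A) (y <#\<^bsub>G\<^esub> A) \<noteq> {})"
      using C.cube_crossing_translates[OF cube] by metis
    have "card Y \<le> N"
    proof (rule N[rule_format, OF Y(2,1)], intro ballI impI conjI)
      fix x y assume xy: "x \<in> Y" "y \<in> Y" "x \<noteq> y"
      have xyc: "x \<in> carrier G" "y \<in> carrier G" using xy Y by auto
      show "x <#\<^bsub>G\<^esub> H \<noteq> y <#\<^bsub>G\<^esub> H" using C.translate_eq_if_coset_eq[OF xyc] cross[OF xy] by blast
      show "\<exists>h\<in>H. \<exists>e\<in>E. \<exists>h'\<in>H. x \<otimes>\<^bsub>G\<^esub> h \<otimes>\<^bsub>G\<^esub> e = y \<otimes>\<^bsub>G\<^esub> h'"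
        by (rule close[rule_format, OF xyc]) (use cross[OF xy] in blast)
    qed
    then show ?thesis using Y(3) by simp
  qed
  then show ?thesis unfolding sageev_complex_finite_dimensional_def by blast
qed

end
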